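(* There exists a nuclear Fréchet space $E$ with the properties $\underline{DN}$ and $\Omega$ such that, for its associated exponent sequence $\varepsilon$, one has $\Delta(E)=\Delta(\Lambda_{1}(\varepsilon))$ and there is no subspace of $E$ which is isomorphic to $\Lambda_{1}(\varepsilon)$.
   Context: **Diameters.** For absolutely convex sets $U,V$ in a Fréchet space $E$ with $V\subseteq CU$ for some $C>0$, the $n$-th Kolmogorov diameter ($n=0,1,2,\dots$) is $d_n(V,U)=\inf\{t>0:\ V\subseteq tU+L \text{ for some linear subspace } L\subseteq E,\ \dim L\le n\}$. **Diametral dimension.** Let $(\|\cdot\|_k)_{k\ge1}$ be an increasing fundamental sequence of seminorms of $E$ and $U_k=\{x\in E:\|x\|_k\le1\}$. The diametral dimension is $$\Delta(E)=\{(t_n)_{n\ge 0}:\ \forall p\ \exists q>p\ \lim_{n\to\infty}t_n d_n(U_q,U_p)=0\}$$ (a set of scalar sequences, independent of the choice of seminorms). **Property $\underline{DN}$:** $\exists k\ \forall j\ \exists l,\ C>0,\ 0<\lambda<1$ with $\|x\|_j\le C\|x\|_k^{\lambda}\|x\|_l^{1-\lambda}$ for all $x\in E$. **Property $\Omega$:** $\forall p\ \exists q\ \forall k\ \exists C>0,\ 0<\theta<1$ with $\|y\|_q^*\le C(\|y\|_p^* )^{1-\theta}(\|y\|_k^* )^{\theta}$ for all $y\in E'$, where $\|y\|_k^*=\sup\{|y(x)|:\|x\|_k\le1\}\in[0,+\infty]$. **Power series spaces.** An exponent sequence is a non-negative increasing sequence $\alpha=(\alpha_n)_{n\ge0}$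 with $\alpha_n\to+\infty$. Then $\Lambda_1(\alpha)=\{x=(x_n)_{n\ge 0}:\|x\|_k=\sum_n|x_n|e^{-\alpha_n/k}<\infty\ \forall k\ge1\}$ and $\Lambda_\infty(\alpha)=\{x:\|x\|_k=\sum_n|x_n|e^{k\alpha_n}<\infty\ \forall k\ge1\}$, with the Fréchet topologies given by these norms. The dual $\Lambda_\infty(\alpha)'$ is identified with the sequence space $\{(t_n):\exists k\ \sup_n|t_n|e^{-k\alpha_n}<\infty\}$. **Associated exponent sequence.** For a nuclear Fréchet space $E$ with $\underline{DN}$ and $\Omega$ there is (known fact) an exponent sequence $\varepsilon=(\varepsilon_n)_{n\ge0}$, unique up to equivalence (each of two equivalent sequences is bounded by a constant multiple of the other, up to finitely many terms), such that $\Delta(\Lambda_1(\varepsilon))\subseteq\Delta(E)\subseteq\Delta(\Lambda_\infty(\varepsilon))$ and, for every exponent sequence $\alpha$: $\Lambda_1(\alpha)\subseteq\Delta(E)$ implies $\Lambda_1(\alpha)\subseteq\Lambda_1(\varepsilon)$, and $\Delta(E)\subseteq\Lambda_\infty(\alpha)'$ implies $\Lambda_\infty(\varepsilon)'\subseteq\Lambda_\infty(\alpha)'$. This $\varepsilon$ is called the associated exponent sequence of $E$. "Subspace" means linear subspace with the induced topology, and "isomorphic" means linearly homeomorphic. *)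

theory Defs
  imports "HOL-Analysis.Analysis" "HOL-Library.Function_Algebras"
begin

text \<open>
  A space is given by a scalar multiplication \<open>s\<close> on an ambient vector space, a linear subspace
  \<open>E\<close> of it as carrier, and a sequence \<open>p 0, p 1, \<dots>\<close> of seminorms on \<open>E\<close>. Seminorms are
  numbered from 0 here, so \<open>p k\<close> is the norm with index \<open>k + 1\<close> of the literature. Values of
  \<open>p\<close> outside \<open>E\<close> are irrelevant. A scalar field of sort
  \<open>{real_normed_field, euclidean_space}\<close> is the real or the complex field, so a type variable of
  this sort covers exactly the two cases.
\<close>

definition seminorm_on ::
  "('k::real_normed_field \<Rightarrow> 'v::ab_group_add \<Rightarrow> 'v) \<Rightarrow> 'v set \<Rightarrow> ('v \<Rightarrow> real) \<Rightarrow> bool" where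
  "seminorm_on s E r \<longleftrightarrow>
     (\<forall>x\<in>E. 0 \<le> r x) \<and> (\<forall>x\<in>E. \<forall>y\<in>E. r (x + y) \<le> r x + r y) \<and>
     (\<forall>c. \<forall>x\<in>E. r (s c x) = norm c * r x)"

definition seminorm_topology :: "'v::ab_group_add set \<Rightarrow> (nat \<Rightarrow> 'v \<Rightarrow> real) \<Rightarrow> 'v topology" where
  "seminorm_topology E p =
     topology_generated_by {{y \<in> E. p k (y - x) < r} |k x r. x \<in> E \<and> 0 < r}"

definition frechet_space ::
  "('k::real_normed_field \<Rightarrow> 'v::ab_group_add \<Rightarrow> 'v) \<Rightarrow> 'v set \<Rightarrow> (nat \<Rightarrow> 'v \<Rightarrow> real) \<Rightarrow> bool" where
  "frechet_space s E p \<longleftrightarrow>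
     vector_space s \<and> module.subspace s E \<and>
     (\<forall>k. seminorm_on s E (p k)) \<and>
     (\<forall>x\<in>E. incseq (\<lambda>k. p k x)) \<and>
     (\<forall>x\<in>E. (\<forall>k. p k x = 0) \<longrightarrow> x = 0) \<and>
     (\<forall>x. range x \<subseteq> E \<longrightarrow>
        (\<forall>k. \<forall>e>0. \<exists>N. \<forall>m\<ge>N. \<forall>n\<ge>N. p k (x m - x n) < e) \<longrightarrow>
        (\<exists>l\<in>E. \<forall>k. (\<lambda>n. p k (x n - l)) \<longlonglongrightarrow> 0))"

definition unit_ball :: "'v set \<Rightarrow> (nat \<Rightarrow> 'v \<Rightarrow> real) \<Rightarrow> nat \<Rightarrow> 'v set" where
  "unit_ball E p k = {x \<in> E. p k x \<le> 1}"

definition linear_on ::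
  "('k::real_normed_field \<Rightarrow> 'v::ab_group_add \<Rightarrow> 'v) \<Rightarrow> ('k \<Rightarrow> 'w::ab_group_add \<Rightarrow> 'w) \<Rightarrow>
   'v set \<Rightarrow> ('v \<Rightarrow> 'w) \<Rightarrow> bool" where
  "linear_on s s' E f \<longleftrightarrow>
     (\<forall>x\<in>E. \<forall>y\<in>E. f (x + y) = f x + f y) \<and> (\<forall>c. \<forall>x\<in>E. f (s c x) = s' c (f x))"

definition top_dual ::
  "('k::real_normed_field \<Rightarrow> 'v::ab_group_add \<Rightarrow> 'v) \<Rightarrow> 'v set \<Rightarrow> (nat \<Rightarrow> 'v \<Rightarrow> real) \<Rightarrow>
   ('v \<Rightarrow> 'k) set" where
  "top_dual s E p =
     {y. linear_on s (*) E y \<and> continuous_map (seminorm_topology E p) euclidean y}"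

definition dual_norm ::
  "'v set \<Rightarrow> (nat \<Rightarrow> 'v \<Rightarrow> real) \<Rightarrow> nat \<Rightarrow> ('v \<Rightarrow> 'k::real_normed_field) \<Rightarrow> ennreal" where
  "dual_norm E p k y = (SUP x\<in>unit_ball E p k. ennreal (norm (y x)))"

text \<open>
  Nuclearity: for every \<open>k\<close> there is \<open>l > k\<close> such that the canonical map from
  \<open>(E, p l)\<close> modulo the kernel of \<open>p l\<close> to \<open>(E, p k)\<close> modulo the kernel of \<open>p k\<close> is a nuclear
  map of normed spaces, i.e. \<open>x = (\<Sum>j. y j x \<cdot> z j)\<close> in the target with
  \<open>(\<Sum>j. \<parallel>y j\<parallel>\<^sub>l\<^sup>* \<cdot> \<parallel>z j\<parallel>\<^sub>k) < \<infinity>\<close>. The quotients are written out: a functional with finite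
  \<open>l\<close>-th dual norm vanishes on the kernel of \<open>p l\<close>, and the \<open>z j\<close> are representatives. The target
  need not be completed, since a vector of the completion is the sum of a series of vectors of the
  normed space whose norms have sum at most twice its own.
\<close>

definition nuclear ::
  "('k::real_normed_field \<Rightarrow> 'v::ab_group_add \<Rightarrow> 'v) \<Rightarrow> 'v set \<Rightarrow> (nat \<Rightarrow> 'v \<Rightarrow> real) \<Rightarrow> bool" where
  "nuclear s E p \<longleftrightarrow>
     (\<forall>k. \<exists>l>k. \<exists>(y :: nat \<Rightarrow> 'v \<Rightarrow> 'k) (z :: nat \<Rightarrow> 'v).
        (\<forall>j. linear_on s (*) E (y j) \<and> dual_norm E p l (y j) < \<infinity> \<and> z j \<in> E) \<and>
        (\<Sum>j. dual_norm E p l (y j) * ennreal (p k (z j))) < \<infinity> \<and>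
        (\<forall>x\<in>E. (\<lambda>n. p k (x - (\<Sum>j<n. s (y j x) (z j)))) \<longlonglongrightarrow> 0))"

definition property_DN :: "'v set \<Rightarrow> (nat \<Rightarrow> 'v \<Rightarrow> real) \<Rightarrow> bool" where
  "property_DN E p \<longleftrightarrow>
     (\<exists>k. \<forall>j. \<exists>l. \<exists>C>0. \<exists>\<kappa>. 0 < \<kappa> \<and> \<kappa> < 1 \<and>
        (\<forall>x\<in>E. p j x \<le> C * p k x powr \<kappa> * p l x powr (1 - \<kappa>)))"

text \<open>Powers with positive exponent on \<open>[0, \<infinity>]\<close>.\<close>

definition epowr :: "ennreal \<Rightarrow> real \<Rightarrow> ennreal" where
  "epowr x a = (if x = \<infinity> then \<infinity> else ennreal (enn2real x powr a))"

text \<open>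
  The convention \<open>0 \<cdot> \<infinity> = 0\<close> for extended reals plays no role below: one dual norm of \<open>y\<close> is zero
  only if \<open>y\<close> vanishes on \<open>E\<close>, and then all of them are zero.
\<close>

definition property_Omega ::
  "('k::real_normed_field \<Rightarrow> 'v::ab_group_add \<Rightarrow> 'v) \<Rightarrow> 'v set \<Rightarrow> (nat \<Rightarrow> 'v \<Rightarrow> real) \<Rightarrow> bool" where
  "property_Omega s E p \<longleftrightarrow>
     (\<forall>m. \<exists>q. \<forall>k. \<exists>C>0. \<exists>\<theta>. 0 < \<theta> \<and> \<theta> < 1 \<and>
        (\<forall>y\<in>top_dual s E p.
           dual_norm E p q y
             \<le> ennreal C * epowr (dual_norm E p m y) (1 - \<theta>) * epowr (dual_norm E p k y) \<theta>))"

text \<open>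
  Finite dimensionality of \<open>L\<close> is required separately because the library's \<open>dim\<close> is 0 on
  infinite-dimensional subspaces.
\<close>

definition kolmogorov_diameter ::
  "('k::real_normed_field \<Rightarrow> 'v::ab_group_add \<Rightarrow> 'v) \<Rightarrow> 'v set \<Rightarrow> nat \<Rightarrow> 'v set \<Rightarrow> 'v set \<Rightarrow> real" where
  "kolmogorov_diameter s E n V U =
     Inf {t. 0 < t \<and>
       (\<exists>L. module.subspace s L \<and> L \<subseteq> E \<and> (\<exists>B. finite B \<and> L \<subseteq> module.span s B) \<and>
            vector_space.dim s L \<le> n \<and> V \<subseteq> {s (of_real t) u + v |u v. u \<in> U \<and> v \<in> L})}"

definition diametral_dimension ::
  "('k::real_normed_field \<Rightarrow> 'v::ab_group_add \<Rightarrow> 'v) \<Rightarrow> 'v set \<Rightarrow> (nat \<Rightarrow> 'v \<Rightarrow> real) \<Rightarrow>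
   (nat \<Rightarrow> 'k) set" where
  "diametral_dimension s E p =
     {t. \<forall>k. \<exists>q>k.
        (\<lambda>n. t n * of_real (kolmogorov_diameter s E n (unit_ball E p q) (unit_ball E p k)))
          \<longlonglongrightarrow> 0}"

text \<open>\<open>(G, q)\<close> is linearly homeomorphic to a linear subspace of \<open>(E, p)\<close> with the induced topology.\<close>

definition has_subspace_isomorphic_to ::
  "('k::real_normed_field \<Rightarrow> 'v::ab_group_add \<Rightarrow> 'v) \<Rightarrow> 'v set \<Rightarrow> (nat \<Rightarrow> 'v \<Rightarrow> real) \<Rightarrow>
   ('k \<Rightarrow> 'w::ab_group_add \<Rightarrow> 'w) \<Rightarrow> 'w set \<Rightarrow> (nat \<Rightarrow> 'w \<Rightarrow> real) \<Rightarrow> bool" where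
  "has_subspace_isomorphic_to s E p s' G q \<longleftrightarrow>
     (\<exists>F f. module.subspace s F \<and> F \<subseteq> E \<and> linear_on s' s G f \<and>
        homeomorphic_map (seminorm_topology G q) (subtopology (seminorm_topology E p) F) f)"

definition exponent_sequence :: "(nat \<Rightarrow> real) \<Rightarrow> bool" where
  "exponent_sequence \<alpha> \<longleftrightarrow> (\<forall>n. 0 \<le> \<alpha> n) \<and> incseq \<alpha> \<and> filterlim \<alpha> at_top sequentially"

definition seq_scale :: "'k::real_normed_field \<Rightarrow> (nat \<Rightarrow> 'k) \<Rightarrow> (nat \<Rightarrow> 'k)" where
  "seq_scale c x = (\<lambda>n. c * x n)"

lemma vector_space_seq_scale: "vector_space seq_scale"
  by unfold_locales (auto simp: seq_scale_def fun_eq_iff algebra_simps)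

definition Lambda1 :: "(nat \<Rightarrow> real) \<Rightarrow> (nat \<Rightarrow> 'k::real_normed_field) set" where
  "Lambda1 \<alpha> = {x. \<forall>k. summable (\<lambda>n. norm (x n) * exp (- (\<alpha> n / real (Suc k))))}"

definition Lambda1_norm :: "(nat \<Rightarrow> real) \<Rightarrow> nat \<Rightarrow> (nat \<Rightarrow> 'k::real_normed_field) \<Rightarrow> real" where
  "Lambda1_norm \<alpha> k x = (\<Sum>n. norm (x n) * exp (- (\<alpha> n / real (Suc k))))"

definition Lambda_inf :: "(nat \<Rightarrow> real) \<Rightarrow> (nat \<Rightarrow> 'k::real_normed_field) set" where
  "Lambda_inf \<alpha> = {x. \<forall>k. summable (\<lambda>n. norm (x n) * exp (real (Suc k) * \<alpha> n))}"

definition Lambda_inf_norm :: "(nat \<Rightarrow> real) \<Rightarrow> nat \<Rightarrow> (nat \<Rightarrow> 'k::real_normed_field) \<Rightarrow> real" where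
  "Lambda_inf_norm \<alpha> k x = (\<Sum>n. norm (x n) * exp (real (Suc k) * \<alpha> n))"

text \<open>The dual of \<open>Lambda_inf \<alpha>\<close>, as a sequence space.\<close>

definition Lambda_inf_dual :: "(nat \<Rightarrow> real) \<Rightarrow> (nat \<Rightarrow> 'k::real_normed_field) set" where
  "Lambda_inf_dual \<alpha> =
     {t. \<exists>k::nat. bdd_above (range (\<lambda>n. norm (t n) * exp (- (real k * \<alpha> n))))}"

definition associated_exponent_sequence ::
  "('k::real_normed_field \<Rightarrow> 'v::ab_group_add \<Rightarrow> 'v) \<Rightarrow> 'v set \<Rightarrow> (nat \<Rightarrow> 'v \<Rightarrow> real) \<Rightarrow>
   (nat \<Rightarrow> real) \<Rightarrow> bool" where
  "associated_exponent_sequence s E p \<epsilon> \<longleftrightarrow>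
     exponent_sequence \<epsilon> \<and>
     diametral_dimension seq_scale (Lambda1 \<epsilon>) (Lambda1_norm \<epsilon>) \<subseteq> diametral_dimension s E p \<and>
     diametral_dimension s E p \<subseteq>
       diametral_dimension seq_scale (Lambda_inf \<epsilon>) (Lambda_inf_norm \<epsilon>) \<and>
     (\<forall>\<alpha>. exponent_sequence \<alpha> \<longrightarrow>
        ((Lambda1 \<alpha> :: (nat \<Rightarrow> 'k) set) \<subseteq> diametral_dimension s E p \<longrightarrow>
           (Lambda1 \<alpha> :: (nat \<Rightarrow> 'k) set) \<subseteq> Lambda1 \<epsilon>) \<and>
        (diametral_dimension s E p \<subseteq> Lambda_inf_dual \<alpha> \<longrightarrow>
           (Lambda_inf_dual \<epsilon> :: (nat \<Rightarrow> 'k) set) \<subseteq> Lambda_inf_dual \<alpha>))"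

end

theory Submission
  imports Defs
begin

text \<open>
  The example is a Koethe space of weighted absolutely summable sequences. Coordinate \<open>n\<close> carries
  in the \<open>k\<close>-th norm the weight \<open>exp (n! \<cdot> g)\<close>, where the profile \<open>g = g(k, n)\<close> is \<open>-1/(k+1)\<close>, as in
  the finite type power series space with exponents \<open>n!\<close>, except that it jumps up by 1 when \<open>k\<close>
  passes a level \<open>jump n\<close>. Every level occurs as \<open>jump n\<close> for infinitely many \<open>n\<close>. All profiles lie
  in an interval of length 2 and grow from each level to the next by an amount bounded below by a
  positive constant that depends on the level only; DN, \<open>\<Omega>\<close> and nuclearity follow from this.

  The jumps are invisible to the diametral dimension. The diameter \<open>d\<^sub>n(U\<^sub>q, U\<^sub>p)\<close> is at least
  \<open>exp (-\<delta> n!)\<close>, where \<open>\<delta>\<close> tends to 0 as \<open>p\<close> grows, unless \<open>jump n\<close> lies in \<open>[p, q)\<close>. Membership of \<open>t\<close>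
  in the diametral dimension gives a \<open>q\<close> for \<open>p\<close> and then an \<open>r\<close> for \<open>q\<close>; since \<open>jump n\<close> is not in both
  \<open>[p, q)\<close> and \<open>[q, r)\<close>, one of the two diameters is large at every \<open>n\<close>. Hence the diametral
  dimension consists of the sequences of subexponential growth in \<open>n!\<close>, which is also the diametral
  dimension of the power series space of finite type
  (\<open>diametral_dimension_jump_space\<close>, \<open>diametral_dimension_Lambda1\<close>). Consequently \<open>n!\<close> is an
  associated exponent sequence, and any other one is equivalent to it (\<open>exponent_comparison\<close>).

  An embedding of the power series space does see the jumps. Let \<open>X\<^sub>n\<close> be the image of the \<open>n\<close>-th unit
  sequence and look at the logarithms of its norms, divided by \<open>n!\<close>. They are bounded away from 0 in
  the norm with index 0, stay below 0, up to a vanishing term, in all norms, and come as close to 0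
  as desired in the \<open>J\<close>-th norm if \<open>J\<close> is large; all of this is uniform in \<open>n\<close>. Take \<open>n\<close> large with
  \<open>jump n = J\<close>. The factorials grow so fast that coordinate \<open>n\<close> is alone on the scale of \<open>n!\<close>: a
  coordinate before \<open>n\<close> cannot make up for the smallness of the norm with index 0, and a coordinate
  after \<open>n\<close> that mattered in the \<open>J\<close>-th norm would be far too large in the next one.
  Coordinate \<open>n\<close> itself gains a factor \<open>exp n!\<close> between these two norms, so it is at most \<open>exp (-n!)\<close>
  in the \<open>J\<close>-th. Thus the \<open>J\<close>-th norm of \<open>X\<^sub>n\<close> is too small
  (\<open>no_power_series_subspace_of_jump_space\<close>).
\<close>

section \<open>Topologies given by seminorms\<close>

text \<open>
  A homogeneous function that is less than 1 on a ball is dominated by the seminorm of the ball. This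
  turns every continuity statement below into an inequality.
\<close>

lemma bound_of_homogeneous:
  fixes s :: "'k::real_normed_field \<Rightarrow> 'v::ab_group_add \<Rightarrow> 'v"
  assumes r: "0 < r" and sE: "\<And>c x. x \<in> E \<Longrightarrow> s c x \<in> E"
    and P: "\<And>c x. x \<in> E \<Longrightarrow> P (s c x) = norm c * P x" "\<And>x. x \<in> E \<Longrightarrow> 0 \<le> P x"
    and Q: "\<And>c x. x \<in> E \<Longrightarrow> Q (s c x) = norm c * Q x"
    and imp: "\<And>x. x \<in> E \<Longrightarrow> P x < r \<Longrightarrow> Q x < 1"
    and x: "x \<in> E"
  shows "Q x \<le> 1 / r * P x"
proof (rule dense_ge)
  fix z assume z: "1 / r * P x < z"
  then have zpos: "0 < z" using P(2)[OF x] r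
    by (meson divide_nonneg_pos le_less_trans mult_nonneg_nonneg zero_le_divide_1_iff less_imp_le)
  let ?c = "of_real (1 / z) :: 'k"
  have "norm ?c = 1 / z" using zpos by (simp only: norm_of_real) simp
  then have "P (s ?c x) = P x / z" "Q (s ?c x) = Q x / z" using P(1)[OF x] Q[OF x] by auto
  moreover have "P x / z < r" using z zpos r by (simp add: field_simps)
  ultimately have "Q x / z < 1" using imp[of "s ?c x"] sE[OF x, of ?c] by simp
  then show "Q x \<le> z" using zpos by (simp add: field_simps)
qed

text \<open>
  The part of the definition of a Frechet space on which the topological arguments rest; completeness
  and separation enter elsewhere.
\<close>

locale seminormed_space =
  fixes s :: "'k::real_normed_field \<Rightarrow> 'v::ab_group_add \<Rightarrow> 'v" and E :: "'v set"
    and p :: "nat \<Rightarrow> 'v \<Rightarrow> real"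
  assumes vs: "vector_space s" and sub: "module.subspace s E"
    and sem: "seminorm_on s E (p k)" and inc: "x \<in> E \<Longrightarrow> incseq (\<lambda>k. p k x)"
begin

lemma closed:
  "0 \<in> E" "x \<in> E \<Longrightarrow> y \<in> E \<Longrightarrow> x + y \<in> E" "x \<in> E \<Longrightarrow> s c x \<in> E"
  "x \<in> E \<Longrightarrow> y \<in> E \<Longrightarrow> x - y \<in> E"
proof -
  interpret vector_space s by (rule vs)
  show "0 \<in> E" "x \<in> E \<Longrightarrow> y \<in> E \<Longrightarrow> x + y \<in> E" "x \<in> E \<Longrightarrow> s c x \<in> E"
    "x \<in> E \<Longrightarrow> y \<in> E \<Longrightarrow> x - y \<in> E"
    using sub by (auto intro: subspace_0 subspace_add subspace_scale subspace_diff)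
qed

lemma seminorm:
  "x \<in> E \<Longrightarrow> 0 \<le> p k x" "x \<in> E \<Longrightarrow> y \<in> E \<Longrightarrow> p k (x + y) \<le> p k x + p k y"
  "x \<in> E \<Longrightarrow> p k (s c x) = norm c * p k x"
  using sem[of k] by (auto simp: seminorm_on_def)

lemma seminorm_0: "p k 0 = 0"
proof -
  interpret vector_space s by (rule vs)
  show ?thesis using seminorm(3)[OF closed(1), of k 0] by simp
qed

lemma seminorm_mono: "x \<in> E \<Longrightarrow> k \<le> l \<Longrightarrow> p k x \<le> p l x"
  using inc[of x] by (auto simp: incseq_def)

lemma topspace_eq: "topspace (seminorm_topology E p) = E"
proof -
  have "x \<in> \<Union>{{y \<in> E. p k (y - x) < r} |k x r. x \<in> E \<and> 0 < r}" if "x \<in> E" for x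
  proof
    show "x \<in> {y \<in> E. p 0 (y - x) < 1}" using that by (simp add: seminorm_0)
    show "{y \<in> E. p 0 (y - x) < 1} \<in> {{y \<in> E. p k (y - x) < r} |k x r. x \<in> E \<and> 0 < r}"
      using that zero_less_one by blast
  qed
  then show ?thesis
    unfolding seminorm_topology_def topology_generated_by_topspace by blast
qed

lemma openin_ball: "x \<in> E \<Longrightarrow> 0 < r \<Longrightarrow> openin (seminorm_topology E p) {y \<in> E. p k (y - x) < r}"
  unfolding seminorm_topology_def by (rule topology_generated_by_Basis) blast

text \<open>
  The defining balls are only a subbasis of the topology. They become a basis because the seminorms
  increase, so that two balls with the same centre contain a third one.
\<close>

lemma openin_contains_ball:
  assumes "openin (seminorm_topology E p) U" "x \<in> U" "x \<in> E"
  shows "\<exists>k r. 0 < r \<and> {y \<in> E. p k (y - x) < r} \<subseteq> U"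
proof -
  have "generate_topology_on {{y \<in> E. p k (y - x) < r} |k x r. x \<in> E \<and> 0 < r} U"
    using assms(1) unfolding seminorm_topology_def openin_topology_generated_by_iff .
  then show ?thesis using assms(2)
  proof induction
    case Empty then show ?case by simp
  next
    case (Int a b)
    then obtain k r k' r' where *: "0 < r" "{y \<in> E. p k (y - x) < r} \<subseteq> a"
      "0 < r'" "{y \<in> E. p k' (y - x) < r'} \<subseteq> b" by auto
    have "{y \<in> E. p (max k k') (y - x) < min r r'} \<subseteq> a \<inter> b"
    proof
      fix y assume y: "y \<in> {y \<in> E. p (max k k') (y - x) < min r r'}"
      then have "y - x \<in> E" using closed(4) assms(3) by blast
      then have "p k (y - x) \<le> p (max k k') (y - x)" "p k' (y - x) \<le> p (max k k') (y - x)"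
        by (auto intro: seminorm_mono)
      then show "y \<in> a \<inter> b" using y *(2,4) by auto
    qed
    then show ?case using *(1,3) by (metis min_less_iff_conj)
  next
    case (UN K)
    then obtain a where a: "a \<in> K" "x \<in> a" by blast
    with UN.IH[of a] obtain k r where "0 < r" "{y \<in> E. p k (y - x) < r} \<subseteq> a" by blast
    with a show ?case by blast
  next
    case (Basis a)
    then obtain k z r where a: "a = {y \<in> E. p k (y - z) < r}" "z \<in> E" "0 < r" by blast
    then have xr: "p k (x - z) < r" using Basis by simp
    have "{y \<in> E. p k (y - x) < r - p k (x - z)} \<subseteq> a"
    proof
      fix y assume y: "y \<in> {y \<in> E. p k (y - x) < r - p k (x - z)}"
      have "p k ((y - x) + (x - z)) \<le> p k (y - x) + p k (x - z)"
        using y a assms(3) by (intro seminorm(2) closed(4)) auto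
      then show "y \<in> a" using y a by simp
    qed
    then show ?case using xr by (metis diff_gt_0_iff_gt)
  qed
qed

lemma bound_of_open_preimage:
  assumes op: "openin (seminorm_topology E p) {x \<in> E. Q x < 1}"
    and Q: "\<And>c x. x \<in> E \<Longrightarrow> Q (s c x) = norm c * Q x"
  shows "\<exists>k C. 0 < C \<and> (\<forall>x\<in>E. Q x \<le> C * p k x)"
proof -
  interpret vector_space s by (rule vs)
  have "Q 0 = 0" using Q[OF closed(1), of 0] by simp
  then obtain k r where r: "0 < r" "{y \<in> E. p k (y - 0) < r} \<subseteq> {x \<in> E. Q x < 1}"
    using openin_contains_ball[OF op, of 0] closed(1) by auto
  have "Q x \<le> 1 / r * p k x" if "x \<in> E" for x
    by (rule bound_of_homogeneous[where E=E and s=s])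
      (use r that seminorm closed Q in auto)
  then show ?thesis using r(1) by (metis zero_less_divide_1_iff)
qed

lemma functional_bound:
  assumes "y \<in> top_dual s E p"
  shows "\<exists>k C. 0 < C \<and> (\<forall>x\<in>E. norm (y x) \<le> C * p k x)"
proof (rule bound_of_open_preimage)
  have "openin (seminorm_topology E p) {x \<in> topspace (seminorm_topology E p). y x \<in> ball 0 1}"
    using assms by (intro openin_continuous_map_preimage[of _ euclidean]) (auto simp: top_dual_def)
  then show "openin (seminorm_topology E p) {x \<in> E. norm (y x) < 1}"
    by (simp add: topspace_eq)
  show "norm (y (s c x)) = norm c * norm (y x)" if "x \<in> E" for c x
    using assms that by (simp add: top_dual_def linear_on_def norm_mult)
qed

end

lemma linear_on_zero:
  assumes "linear_on s s' E f" "(0::'v::ab_group_add) \<in> E"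
  shows "f 0 = (0 :: 'w::ab_group_add)"
proof -
  have "f (0 + 0) = f 0 + f 0" using assms unfolding linear_on_def by blast
  then show ?thesis by simp
qed

text \<open>
  An isomorphism onto a subspace is used only through its two-sided estimates: continuity bounds the
  norms of the image, and openness onto the subspace bounds the norms of the preimage.
\<close>

lemma subspace_isomorphism_bounds:
  fixes s :: "'k::real_normed_field \<Rightarrow> 'v::ab_group_add \<Rightarrow> 'v"
    and s' :: "'k \<Rightarrow> 'w::ab_group_add \<Rightarrow> 'w"
  assumes E: "seminormed_space s E p" and G: "seminormed_space s' G q"
    and emb: "has_subspace_isomorphic_to s E p s' G q"
  obtains f where "\<And>x. x \<in> G \<Longrightarrow> f x \<in> E"
    and "\<And>k. \<exists>l C. 0 < C \<and> (\<forall>x\<in>G. p k (f x) \<le> C * q l x)"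
    and "\<And>k. \<exists>l C. 0 < C \<and> (\<forall>x\<in>G. q k x \<le> C * p l (f x))"
proof -
  interpret E: seminormed_space s E p by (rule E)
  interpret G: seminormed_space s' G q by (rule G)
  obtain F f where F: "module.subspace s F" "F \<subseteq> E" and lin: "linear_on s' s G f"
    and hom: "homeomorphic_map (seminorm_topology G q) (subtopology (seminorm_topology E p) F) f"
    using emb unfolding has_subspace_isomorphic_to_def by blast
  have topF: "topspace (subtopology (seminorm_topology E p) F) = F"
    using F(2) by (simp add: E.topspace_eq Int_absorb1)
  have im: "f ` G = F"
    using homeomorphic_imp_surjective_map[OF hom] topF G.topspace_eq by metis
  have inj: "inj_on f G"
    using homeomorphic_imp_injective_map[OF hom] by (simp add: G.topspace_eq)
  have fE: "f x \<in> E" if "x \<in> G" for x using that im F(2) by blast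
  have f0: "f 0 = 0" using linear_on_zero[OF lin G.closed(1)] .
  have fs: "f (s' c x) = s c (f x)" if "x \<in> G" for c x
    using lin that by (simp add: linear_on_def)
  have cont: "continuous_map (seminorm_topology G q) (seminorm_topology E p) f"
    using homeomorphic_imp_continuous_map[OF hom] by (simp add: continuous_map_in_subtopology)
  show thesis
  proof (rule that)
    fix k
    show "\<exists>l C. 0 < C \<and> (\<forall>x\<in>G. p k (f x) \<le> C * q l x)"
    proof (rule G.bound_of_open_preimage)
      have "openin (seminorm_topology G q)
              {x \<in> topspace (seminorm_topology G q). f x \<in> {y \<in> E. p k (y - 0) < 1}}"
        by (intro openin_continuous_map_preimage[OF cont] E.openin_ball E.closed(1)) simp
      moreover have "{x \<in> topspace (seminorm_topology G q). f x \<in> {y \<in> E. p k (y - 0) < 1}}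
          = {x \<in> G. p k (f x) < 1}"
        using fE by (auto simp: G.topspace_eq)
      ultimately show "openin (seminorm_topology G q) {x \<in> G. p k (f x) < 1}" by simp
      show "p k (f (s' c x)) = norm c * p k (f x)" if "x \<in> G" for c x
        using that by (simp add: fs E.seminorm(3) fE)
    qed
    have "open_map (seminorm_topology G q) (subtopology (seminorm_topology E p) F) f"
      using homeomorphic_imp_open_map[OF hom] .
    then have "openin (subtopology (seminorm_topology E p) F) (f ` {x \<in> G. q k (x - 0) < 1})"
      using G.openin_ball[OF G.closed(1), of 1 k] unfolding open_map_def by simp
    then obtain W where W: "openin (seminorm_topology E p) W"
      and fW: "f ` {x \<in> G. q k x < 1} = W \<inter> F"
      unfolding openin_subtopology by auto
    have "f 0 \<in> f ` {x \<in> G. q k x < 1}"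
      using G.closed(1) G.seminorm_0[of k] by (intro imageI) simp
    then have "0 \<in> W" unfolding fW f0 by blast
    then obtain l r where r: "0 < r" and lr: "{y \<in> E. p l (y - 0) < r} \<subseteq> W"
      using E.openin_contains_ball[OF W _ E.closed(1)] by blast
    have "q k x \<le> 1 / r * p l (f x)" if "x \<in> G" for x
    proof (rule bound_of_homogeneous[where E=G and s=s' and P="\<lambda>x. p l (f x)", OF r])
      fix z assume z: "z \<in> G" "p l (f z) < r"
      then have "f z \<in> {y \<in> E. p l (y - 0) < r}" using fE by simp
      then have "f z \<in> W \<inter> F" using lr im z(1) by blast
      then have "f z \<in> f ` {x \<in> G. q k x < 1}" unfolding fW .
      then obtain z' where "z' \<in> G" "q k z' < 1" "f z' = f z" by (elim imageE) auto
      then show "q k z < 1" using inj_onD[OF inj, of z' z] z(1) by simp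
    next
      show "p l (f (s' c z)) = norm c * p l (f z)" if "z \<in> G" for c z
        using that by (simp add: fs E.seminorm(3) fE)
    qed (simp_all add: G.closed G.seminorm E.seminorm fE that)
    then show "\<exists>l C. 0 < C \<and> (\<forall>x\<in>G. q k x \<le> C * p l (f x))"
      using r by (metis zero_less_divide_1_iff)
  qed (rule fE)
qed

section \<open>Koethe sequence spaces\<close>

definition koethe :: "(nat \<Rightarrow> nat \<Rightarrow> real) \<Rightarrow> (nat \<Rightarrow> 'k::real_normed_field) set" where
  "koethe w = {x. \<forall>k. summable (\<lambda>n. norm (x n) * w k n)}"

definition koethe_norm ::
    "(nat \<Rightarrow> nat \<Rightarrow> real) \<Rightarrow> nat \<Rightarrow> (nat \<Rightarrow> 'k::real_normed_field) \<Rightarrow> real" where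
  "koethe_norm w k x = (\<Sum>n. norm (x n) * w k n)"

definition unit_seq :: "nat \<Rightarrow> nat \<Rightarrow> 'k::zero_neq_one" where
  "unit_seq m = (\<lambda>n. if n = m then 1 else 0)"

interpretation seq_space: vector_space "seq_scale :: 'k::real_normed_field \<Rightarrow> _"
  by (rule vector_space_seq_scale)

lemma seq_scale_apply: "seq_scale c x n = c * x n"
  by (simp add: seq_scale_def)

lemma sum_seq_apply: "(\<Sum>i\<in>A. f i) n = (\<Sum>i\<in>A. f i n)" for f :: "'i \<Rightarrow> 'j \<Rightarrow> 'k::comm_monoid_add"
  by (induction A rule: infinite_finite_induct) auto

lemma restriction_eq_sum_unit_seq:
  fixes x :: "nat \<Rightarrow> 'k::real_normed_field"
  shows "(\<lambda>n. if n < N then x n else 0) = (\<Sum>j<N. seq_scale (x j) (unit_seq j))"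
proof
  fix n
  have "(\<Sum>j<N. seq_scale (x j) (unit_seq j)) n = (\<Sum>j<N. if n = j then x j else 0)"
    by (simp add: sum_seq_apply seq_scale_apply unit_seq_def if_distrib cong: if_cong)
  then show "(if n < N then x n else 0) = (\<Sum>j<N. seq_scale (x j) (unit_seq j)) n"
    by simp
qed

locale koethe_matrix =
  fixes w :: "nat \<Rightarrow> nat \<Rightarrow> real"
  assumes pos: "0 < w k n" and mono: "incseq (\<lambda>k. w k n)"
begin

lemma nonneg: "0 \<le> w k n"
  using pos less_imp_le by blast

lemma koethe_summable: "x \<in> koethe w \<Longrightarrow> summable (\<lambda>n. norm (x n) * w k n)"
  by (simp add: koethe_def)

lemma term_le_norm: "x \<in> koethe w \<Longrightarrow> norm (x n) * w k n \<le> koethe_norm w k x"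
  unfolding koethe_norm_def
  using sum_le_suminf[OF koethe_summable, of x "{n}" k] by (simp add: nonneg)

lemma coordinate_le: "x \<in> koethe w \<Longrightarrow> norm (x n) \<le> koethe_norm w k x / w k n"
  using term_le_norm[of x n k] pos[of k n] by (simp add: pos_le_divide_eq)

lemma koethe_norm_nonneg: "x \<in> koethe w \<Longrightarrow> 0 \<le> koethe_norm w k x"
  unfolding koethe_norm_def by (intro suminf_nonneg koethe_summable) (auto simp: nonneg)

lemma koethe_norm_eq_0: "x \<in> koethe w \<Longrightarrow> koethe_norm w k x = 0 \<Longrightarrow> x = 0"
proof
  fix n assume "x \<in> koethe w" "koethe_norm w k x = 0"
  then show "x n = 0 n" using coordinate_le[of x n k] by simp
qed

lemma finite_support_in_koethe: "finite {n. x n \<noteq> 0} \<Longrightarrow> x \<in> koethe w"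
  unfolding koethe_def by (auto intro!: summable_finite[of "{n. x n \<noteq> 0}"])

lemma dominated_in_koethe:
  assumes "x \<in> koethe w" "\<And>n. norm (y n) \<le> norm (x n)"
  shows "y \<in> koethe w" "koethe_norm w k y \<le> koethe_norm w k x"
proof -
  have le: "norm (y n) * w k n \<le> norm (x n) * w k n" for k n
    using assms(2) nonneg by (rule mult_right_mono)
  have "summable (\<lambda>n. norm (y n) * w k n)" for k
    by (rule summable_comparison_test'[OF koethe_summable[OF assms(1), of k], of 0])
      (use le in \<open>auto simp: nonneg\<close>)
  then show y: "y \<in> koethe w" by (simp add: koethe_def)
  show "koethe_norm w k y \<le> koethe_norm w k x"
    unfolding koethe_norm_def by (intro suminf_le le koethe_summable y assms(1))
qed

lemma unit_seq_in_koethe: "unit_seq m \<in> koethe w"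
  by (rule finite_support_in_koethe) (simp add: unit_seq_def)

lemma koethe_norm_unit_seq: "koethe_norm w k (unit_seq m) = w k m"
proof -
  have "koethe_norm w k (unit_seq m :: nat \<Rightarrow> 'a) = (\<Sum>n\<in>{m}. norm (unit_seq m n :: 'a) * w k n)"
    unfolding koethe_norm_def by (rule suminf_finite) (auto simp: unit_seq_def)
  then show ?thesis by (simp add: unit_seq_def)
qed

lemma seminormed_space_koethe:
  "seminormed_space (seq_scale :: 'k::real_normed_field \<Rightarrow> _) (koethe w) (koethe_norm w)"
proof
  have add: "x + y \<in> koethe w \<and> koethe_norm w k (x + y) \<le> koethe_norm w k x + koethe_norm w k y"
    if "x \<in> koethe w" "y \<in> koethe w" for x y :: "nat \<Rightarrow> 'k" and k
  proof -
    have le: "norm (x n + y n) * w k n \<le> norm (x n) * w k n + norm (y n) * w k n" for n k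
      using mult_right_mono[OF norm_triangle_ineq nonneg] by (simp add: distrib_right)
    have s: "summable (\<lambda>n. norm (x n) * w k n + norm (y n) * w k n)" for k
      using that by (intro summable_add koethe_summable)
    have "summable (\<lambda>n. norm (x n + y n) * w k n)" for k
      by (rule summable_comparison_test'[OF s[of k], of 0]) (use le in \<open>auto simp: nonneg\<close>)
    moreover from this have "(\<Sum>n. norm (x n + y n) * w k n)
        \<le> (\<Sum>n. norm (x n) * w k n + norm (y n) * w k n)"
      by (intro suminf_le le s)
    ultimately show ?thesis
      using that by (simp add: koethe_def koethe_norm_def suminf_add)
  qed
  have scale: "seq_scale c x \<in> koethe w \<and> koethe_norm w k (seq_scale c x) = norm c * koethe_norm w k x"
    if "x \<in> koethe w" for x :: "nat \<Rightarrow> 'k" and k c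
  proof -
    have "summable (\<lambda>n. norm (seq_scale c x n) * w k n)" for k
      using summable_mult[OF koethe_summable[OF that, of k], of "norm c"]
      by (simp add: seq_scale_apply norm_mult mult.assoc)
    moreover have "koethe_norm w k (seq_scale c x) = norm c * koethe_norm w k x"
      using suminf_mult[OF koethe_summable[OF that, of k], of "norm c"]
      by (simp add: koethe_norm_def seq_scale_apply norm_mult mult.assoc)
    ultimately show ?thesis by (simp add: koethe_def)
  qed
  show "module.subspace (seq_scale :: 'k \<Rightarrow> _) (koethe w)"
    unfolding seq_space.subspace_def using add scale by (auto intro: finite_support_in_koethe)
  show "seminorm_on (seq_scale :: 'k \<Rightarrow> _) (koethe w) (koethe_norm w k)" for k
    unfolding seminorm_on_def using add scale koethe_norm_nonneg by blast
  show "incseq (\<lambda>k. koethe_norm w k x)" if "x \<in> koethe w" for x :: "nat \<Rightarrow> 'k"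
    unfolding koethe_norm_def
    using mono that
    by (intro incseq_SucI suminf_le koethe_summable mult_left_mono) (auto simp: incseq_Suc_iff)
qed

lemma koethe_complete:
  fixes x :: "nat \<Rightarrow> nat \<Rightarrow> 'k::{real_normed_field, complete_space}"
  assumes x: "\<And>n. x n \<in> koethe w"
    and cauchy: "\<And>k e. 0 < e \<Longrightarrow> \<exists>N. \<forall>m\<ge>N. \<forall>n\<ge>N. koethe_norm w k (x m - x n) < e"
  shows "\<exists>l\<in>koethe w. \<forall>k. (\<lambda>n. koethe_norm w k (x n - l)) \<longlonglongrightarrow> 0"
proof -
  interpret seminormed_space "seq_scale :: 'k \<Rightarrow> _" "koethe w" "koethe_norm w"
    by (rule seminormed_space_koethe)
  have "Cauchy (\<lambda>n. x n i)" for i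
  proof (rule metric_CauchyI)
    fix e :: real assume "0 < e"
    then obtain N where N: "\<forall>m\<ge>N. \<forall>n\<ge>N. koethe_norm w 0 (x m - x n) < e * w 0 i"
      using cauchy[of "e * w 0 i" 0] pos[of 0 i] by auto
    have "dist (x m i) (x n i) < e" if "m \<ge> N" "n \<ge> N" for m n
    proof -
      have "norm ((x m - x n) i) \<le> koethe_norm w 0 (x m - x n) / w 0 i"
        using x by (intro coordinate_le closed(4))
      also have "\<dots> < e" using N that pos[of 0 i] by (simp add: pos_divide_less_eq)
      finally show ?thesis by (simp add: dist_norm)
    qed
    then show "\<exists>N. \<forall>m\<ge>N. \<forall>n\<ge>N. dist (x m i) (x n i) < e" by blast
  qed
  then have "\<forall>i. \<exists>l. (\<lambda>n. x n i) \<longlonglongrightarrow> l" by (simp add: convergent_eq_Cauchy)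
  then obtain l where l: "\<And>i. (\<lambda>n. x n i) \<longlonglongrightarrow> l i" by metis
  \<comment> \<open>Fatou: an estimate on finite sections survives the limit in the second index.\<close>
  have key: "summable (\<lambda>i. norm ((x m - l) i) * w k i) \<and> koethe_norm w k (x m - l) \<le> e"
    if N: "\<forall>m\<ge>N. \<forall>n\<ge>N. koethe_norm w k (x m - x n) < e" and m: "m \<ge> N" for m k e N
  proof -
    have le: "(\<Sum>i<M. norm ((x m - l) i) * w k i) \<le> e" for M
    proof (rule tendsto_upperbound)
      show "(\<lambda>n. \<Sum>i<M. norm (x m i - x n i) * w k i) \<longlonglongrightarrow> (\<Sum>i<M. norm ((x m - l) i) * w k i)"
        using l by (auto intro!: tendsto_intros)
      have "(\<Sum>i<M. norm (x m i - x n i) * w k i) \<le> e" if "n \<ge> N" for n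
      proof -
        have d: "x m - x n \<in> koethe w" using x by (intro closed(4))
        have "(\<Sum>i<M. norm ((x m - x n) i) * w k i) \<le> koethe_norm w k (x m - x n)"
          unfolding koethe_norm_def by (rule sum_le_suminf[OF koethe_summable[OF d]]) (auto simp: nonneg)
        also have "\<dots> \<le> e" using N m that by (simp add: less_imp_le)
        finally show ?thesis by simp
      qed
      then show "\<forall>\<^sub>F n in sequentially. (\<Sum>i<M. norm (x m i - x n i) * w k i) \<le> e"
        by (rule eventually_sequentiallyI)
    qed simp
    have s: "summable (\<lambda>i. norm ((x m - l) i) * w k i)"
    proof (rule bounded_imp_summable)
      show "0 \<le> norm ((x m - l) i) * w k i" for i by (simp add: nonneg)
      show "(\<Sum>i\<le>M. norm ((x m - l) i) * w k i) \<le> e" for M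
        using le[of "Suc M"] by (simp only: lessThan_Suc_atMost)
    qed
    moreover have "koethe_norm w k (x m - l) \<le> e"
      unfolding koethe_norm_def by (rule suminf_le_const[OF s le])
    ultimately show ?thesis by blast
  qed
  have "summable (\<lambda>i. norm (l i) * w k i)" for k
  proof -
    obtain N where N: "\<forall>m\<ge>N. \<forall>n\<ge>N. koethe_norm w k (x m - x n) < 1"
      using cauchy[of 1 k] by auto
    have "summable (\<lambda>i. norm ((x N - l) i) * w k i + norm (x N i) * w k i)"
      using key[OF N] koethe_summable[OF x] by (intro summable_add) auto
    then show ?thesis
    proof (rule summable_comparison_test'[of _ 0])
      fix n
      have "norm (l n) \<le> norm (x N n - l n) + norm (x N n)"
        by (metis norm_minus_commute norm_triangle_sub add.commute)
      then have "norm (l n) * w k n \<le> (norm (x N n - l n) + norm (x N n)) * w k n"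
        using nonneg by (rule mult_right_mono)
      then show "norm (norm (l n) * w k n) \<le> norm ((x N - l) n) * w k n + norm (x N n) * w k n"
        by (simp add: nonneg distrib_right)
    qed
  qed
  then have lk: "l \<in> koethe w" by (simp add: koethe_def)
  have "(\<lambda>n. koethe_norm w k (x n - l)) \<longlonglongrightarrow> 0" for k
  proof (rule LIMSEQ_I)
    fix r :: real assume "0 < r"
    then obtain N where N: "\<forall>m\<ge>N. \<forall>n\<ge>N. koethe_norm w k (x m - x n) < r / 2"
      using cauchy[of "r / 2" k] by auto
    have "norm (koethe_norm w k (x n - l) - 0) < r" if "n \<ge> N" for n
    proof -
      have "0 \<le> koethe_norm w k (x n - l)" using x lk by (intro koethe_norm_nonneg closed(4))
      then show ?thesis using key[OF N that] \<open>0 < r\<close> by simp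
    qed
    then show "\<exists>N. \<forall>n\<ge>N. norm (koethe_norm w k (x n - l) - 0) < r" by blast
  qed
  then show ?thesis using lk by blast
qed

lemma frechet_space_koethe:
  "frechet_space (seq_scale :: 'k::{real_normed_field, complete_space} \<Rightarrow> _) (koethe w) (koethe_norm w)"
proof -
  interpret seminormed_space "seq_scale :: 'k \<Rightarrow> _" "koethe w" "koethe_norm w"
    by (rule seminormed_space_koethe)
  have "\<exists>l\<in>koethe w. \<forall>k. (\<lambda>n. koethe_norm w k (x n - l)) \<longlonglongrightarrow> 0"
    if "range x \<subseteq> koethe w"
      "\<forall>k. \<forall>e>0. \<exists>N. \<forall>m\<ge>N. \<forall>n\<ge>N. koethe_norm w k (x m - x n) < e" for x :: "nat \<Rightarrow> nat \<Rightarrow> 'k"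
    by (rule koethe_complete) (use that in auto)
  then show ?thesis
    unfolding frechet_space_def using vs sub sem inc koethe_norm_eq_0 by blast
qed

lemma dual_norm_ge: "ennreal (norm (y (unit_seq n)) / w k n) \<le> dual_norm (koethe w) (koethe_norm w) k y"
  if y: "linear_on seq_scale (*) (koethe w) y" for y :: "(nat \<Rightarrow> 'k::real_normed_field) \<Rightarrow> 'k"
proof -
  let ?c = "of_real (1 / w k n) :: 'k"
  interpret seminormed_space "seq_scale :: 'k \<Rightarrow> _" "koethe w" "koethe_norm w"
    by (rule seminormed_space_koethe)
  have c: "norm ?c = 1 / w k n" using pos[of k n] by (simp only: norm_of_real) simp
  have "koethe_norm w k (seq_scale ?c (unit_seq n)) = 1"
    unfolding seminorm(3)[OF unit_seq_in_koethe] c using pos[of k n] by (simp add: koethe_norm_unit_seq)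
  then have "seq_scale ?c (unit_seq n) \<in> unit_ball (koethe w) (koethe_norm w) k"
    unfolding unit_ball_def using closed(3)[OF unit_seq_in_koethe] by simp
  then have "ennreal (norm (y (seq_scale ?c (unit_seq n)))) \<le> dual_norm (koethe w) (koethe_norm w) k y"
    unfolding dual_norm_def by (rule SUP_upper)
  moreover have "y (seq_scale ?c (unit_seq n)) = ?c * y (unit_seq n)"
    using y unit_seq_in_koethe unfolding linear_on_def by blast
  ultimately show ?thesis by (simp only: norm_mult c) simp
qed

text \<open>
  The unit sequences form a Schauder basis: the norm of the remainder is the tail of a convergent
  series.
\<close>

lemma sections_converge:
  fixes x :: "nat \<Rightarrow> 'k::real_normed_field"
  assumes x: "x \<in> koethe w"
  shows "(\<lambda>N. koethe_norm w k (x - (\<Sum>j<N. seq_scale (x j) (unit_seq j)))) \<longlonglongrightarrow> 0"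
proof -
  have "koethe_norm w k (x - (\<Sum>j<N. seq_scale (x j) (unit_seq j)))
      = (\<Sum>i. norm (x (i + N)) * w k (i + N))" for N
  proof -
    let ?f = "\<lambda>n. norm ((x - (\<Sum>j<N. seq_scale (x j) (unit_seq j))) n) * w k n"
    have f: "?f = (\<lambda>n. if n < N then 0 else norm (x n) * w k n)"
      unfolding restriction_eq_sum_unit_seq[symmetric] by auto
    have "summable ?f" unfolding f
      by (rule summable_comparison_test'[OF koethe_summable[OF x, of k], of 0]) (auto simp: nonneg)
    then have "suminf ?f = (\<Sum>i. ?f (i + N)) + sum ?f {..<N}"
      by (rule suminf_split_initial_segment)
    moreover have "sum ?f {..<N} = 0" unfolding f by simp
    moreover have "(\<lambda>i. ?f (i + N)) = (\<lambda>i. norm (x (i + N)) * w k (i + N))"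
      using fun_cong[OF f] by auto
    ultimately show ?thesis unfolding koethe_norm_def by simp
  qed
  moreover have "(\<lambda>N. \<Sum>i. norm (x (i + N)) * w k (i + N)) \<longlonglongrightarrow> 0"
  proof (rule LIMSEQ_I)
    fix r :: real assume "0 < r"
    from suminf_exist_split[OF this koethe_summable[OF x, of k]]
    show "\<exists>N. \<forall>n\<ge>N. norm ((\<Sum>i. norm (x (i + n)) * w k (i + n)) - 0) < r" by simp
  qed
  ultimately show ?thesis by simp
qed

text \<open>
  The identity is the sum of the coordinate functionals tensored with the unit sequences; their norms
  are \<open>1 / w (Suc k) n\<close> at most and \<open>w k n\<close>.
\<close>

lemma nuclear_koethe:
  assumes "\<And>k. summable (\<lambda>n. w k n / w (Suc k) n)"
  shows "nuclear (seq_scale :: 'k::real_normed_field \<Rightarrow> _) (koethe w) (koethe_norm w)"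
  unfolding nuclear_def
proof (intro allI exI conjI)
  fix k j
  let ?y = "\<lambda>j x. x j :: 'k"
  have bound: "dual_norm (koethe w) (koethe_norm w) (Suc k) (?y j) \<le> ennreal (1 / w (Suc k) j)" for j
    unfolding dual_norm_def
  proof (intro SUP_least ennreal_leI)
    fix x :: "nat \<Rightarrow> 'k" assume "x \<in> unit_ball (koethe w) (koethe_norm w) (Suc k)"
    then have x: "x \<in> koethe w" "koethe_norm w (Suc k) x \<le> 1" by (auto simp: unit_ball_def)
    show "norm (x j) \<le> 1 / w (Suc k) j"
      using coordinate_le[OF x(1), of j "Suc k"] divide_right_mono[OF x(2) nonneg[of "Suc k" j]]
      by linarith
  qed
  show "k < Suc k" by simp
  show "linear_on seq_scale (*) (koethe w) (?y j)"
    by (simp add: linear_on_def seq_scale_def)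
  show "dual_norm (koethe w) (koethe_norm w) (Suc k) (?y j) < \<infinity>"
    using bound[of j] by (metis ennreal_less_top infinity_ennreal_def order.strict_trans1)
  show "unit_seq j \<in> koethe w" by (rule unit_seq_in_koethe)
  have "(\<Sum>j. dual_norm (koethe w) (koethe_norm w) (Suc k) (?y j) * ennreal (koethe_norm w k (unit_seq j :: nat \<Rightarrow> 'k)))
      \<le> (\<Sum>j. ennreal (w k j / w (Suc k) j))"
  proof (rule suminf_le)
    fix j
    have "dual_norm (koethe w) (koethe_norm w) (Suc k) (?y j) * ennreal (w k j)
        \<le> ennreal (1 / w (Suc k) j) * ennreal (w k j)"
      by (rule mult_right_mono[OF bound]) simp
    also have "\<dots> = ennreal (w k j / w (Suc k) j)"
      by (simp add: ennreal_mult[symmetric] nonneg)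
    finally show "dual_norm (koethe w) (koethe_norm w) (Suc k) (?y j)
        * ennreal (koethe_norm w k (unit_seq j :: nat \<Rightarrow> 'k)) \<le> ennreal (w k j / w (Suc k) j)"
      by (simp add: koethe_norm_unit_seq)
  qed auto
  also have "\<dots> = ennreal (\<Sum>j. w k j / w (Suc k) j)"
    using assms by (intro suminf_ennreal2) (auto simp: nonneg)
  also have "\<dots> < \<infinity>" by simp
  finally show "(\<Sum>j. dual_norm (koethe w) (koethe_norm w) (Suc k) (?y j)
      * ennreal (koethe_norm w k (unit_seq j :: nat \<Rightarrow> 'k))) < \<infinity>" .
  show "\<forall>x\<in>koethe w. (\<lambda>N. koethe_norm w k (x - (\<Sum>j<N. seq_scale (?y j x) (unit_seq j)))) \<longlonglongrightarrow> 0"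
    using sections_converge by blast
qed

text \<open>
  Hoelder's inequality transports interpolation between weights to interpolation between the norms.
  After normalising both norms on the right to 1 it is the weighted inequality between arithmetic and
  geometric mean in each coordinate.
\<close>

lemma property_DN_koethe:
  assumes "\<And>j. \<exists>l \<kappa>. 0 < \<kappa> \<and> \<kappa> < 1 \<and> (\<forall>n. w j n \<le> w k n powr \<kappa> * w l n powr (1 - \<kappa>))"
  shows "property_DN (koethe w :: (nat \<Rightarrow> 'k::real_normed_field) set) (koethe_norm w)"
  unfolding property_DN_def
proof (rule exI[of _ k], rule allI)
  fix j
  obtain l \<kappa> where \<kappa>: "0 < \<kappa>" "\<kappa> < 1" and le: "\<And>n. w j n \<le> w k n powr \<kappa> * w l n powr (1 - \<kappa>)"
    using assms by blast
  have "koethe_norm w j x \<le> 1 * koethe_norm w k x powr \<kappa> * koethe_norm w l x powr (1 - \<kappa>)"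
    if x: "x \<in> koethe w" for x :: "nat \<Rightarrow> 'k"
  proof (cases "x = 0")
    case True
    then show ?thesis by (simp add: koethe_norm_def)
  next
    case False
    define a b where "a = koethe_norm w k x" and "b = koethe_norm w l x"
    have ab: "0 < a" "0 < b"
      using koethe_norm_eq_0[OF x] koethe_norm_nonneg[OF x] False by (auto simp: a_def b_def less_le)
    let ?u = "\<lambda>n. norm (x n) * w k n / a" and ?v = "\<lambda>n. norm (x n) * w l n / b"
    have sums: "?u sums 1" "?v sums 1"
      using sums_divide[OF summable_sums[OF koethe_summable[OF x, of k]], of a]
        sums_divide[OF summable_sums[OF koethe_summable[OF x, of l]], of b] ab
      by (auto simp: a_def b_def koethe_norm_def)
    have major: "(\<lambda>n. a powr \<kappa> * b powr (1 - \<kappa>) * (\<kappa> * ?u n + (1 - \<kappa>) * ?v n))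
        sums (a powr \<kappa> * b powr (1 - \<kappa>) * (\<kappa> * 1 + (1 - \<kappa>) * 1))"
      by (intro sums_mult sums_add sums)
    have split: "(a * u) powr \<kappa> * (b * v) powr (1 - \<kappa>)
        = a powr \<kappa> * b powr (1 - \<kappa>) * (u powr \<kappa> * v powr (1 - \<kappa>))" if "0 \<le> u" "0 \<le> v" for u v
      using ab that by (simp add: powr_mult)
    have pointwise: "norm (x n) * w j n \<le> a powr \<kappa> * b powr (1 - \<kappa>) * (\<kappa> * ?u n + (1 - \<kappa>) * ?v n)" for n
    proof -
      have "norm (x n) * w j n \<le> norm (x n) * (w k n powr \<kappa> * w l n powr (1 - \<kappa>))"
        by (rule mult_left_mono[OF le]) simp
      also have "\<dots> = (norm (x n) * w k n) powr \<kappa> * (norm (x n) * w l n) powr (1 - \<kappa>)"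
      proof -
        have "norm (x n) = norm (x n) powr \<kappa> * norm (x n) powr (1 - \<kappa>)"
          by (simp add: powr_add[symmetric])
        then show ?thesis by (simp add: powr_mult nonneg)
      qed
      also have "\<dots> = (a * ?u n) powr \<kappa> * (b * ?v n) powr (1 - \<kappa>)" using ab by simp
      also have "\<dots> = a powr \<kappa> * b powr (1 - \<kappa>) * (?u n powr \<kappa> * ?v n powr (1 - \<kappa>))"
        using ab nonneg by (intro split) auto
      also have "\<dots> \<le> a powr \<kappa> * b powr (1 - \<kappa>) * (\<kappa> * ?u n + (1 - \<kappa>) * ?v n)"
      proof (rule mult_left_mono)
        show "?u n powr \<kappa> * ?v n powr (1 - \<kappa>) \<le> \<kappa> * ?u n + (1 - \<kappa>) * ?v n"
        proof (cases "x n = 0")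
          case False
          then show ?thesis using ab pos \<kappa> by (intro Youngs_inequality_0) auto
        qed simp
      qed simp
      finally show ?thesis .
    qed
    have "koethe_norm w j x \<le> a powr \<kappa> * b powr (1 - \<kappa>) * (\<kappa> * 1 + (1 - \<kappa>) * 1)"
      unfolding koethe_norm_def
      by (rule sums_le[OF pointwise summable_sums[OF koethe_summable[OF x]] major])
    then show ?thesis by (simp add: a_def b_def)
  qed
  then show "\<exists>l. \<exists>C>0. \<exists>\<kappa>. 0 < \<kappa> \<and> \<kappa> < 1 \<and> (\<forall>x\<in>(koethe w :: (nat \<Rightarrow> 'k) set).
      koethe_norm w j x \<le> C * koethe_norm w k x powr \<kappa> * koethe_norm w l x powr (1 - \<kappa>))"
    using \<kappa> zero_less_one by blast
qed

text \<open>
  Together with \<open>dual_norm_ge\<close> this says that the dual of a weighted summable space is a weighted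
  space of bounded sequences. Continuity of \<open>y\<close> is needed to pass from finite sections to all of the
  space.
\<close>

lemma dual_norm_le:
  fixes y :: "(nat \<Rightarrow> 'k::real_normed_field) \<Rightarrow> 'k"
  assumes y: "y \<in> top_dual seq_scale (koethe w) (koethe_norm w)"
    and le: "\<And>n. norm (y (unit_seq n)) \<le> M * w k n"
  shows "dual_norm (koethe w) (koethe_norm w) k y \<le> ennreal M"
  unfolding dual_norm_def
proof (intro SUP_least ennreal_leI)
  fix x :: "nat \<Rightarrow> 'k" assume "x \<in> unit_ball (koethe w) (koethe_norm w) k"
  then have x: "x \<in> koethe w" "koethe_norm w k x \<le> 1" by (auto simp: unit_ball_def)
  interpret seminormed_space "seq_scale :: 'k \<Rightarrow> _" "koethe w" "koethe_norm w"
    by (rule seminormed_space_koethe)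
  have lin: "linear_on seq_scale (*) (koethe w) y" using y by (simp add: top_dual_def)
  have M: "0 \<le> M"
    using order_trans[OF norm_ge_zero le[of 0]] pos[of k 0] by (simp add: zero_le_mult_iff not_le)
  obtain l C where C: "0 < C" "\<And>x. x \<in> koethe w \<Longrightarrow> norm (y x) \<le> C * koethe_norm w l x"
    using functional_bound[OF y] by blast
  let ?s = "\<lambda>N. \<Sum>j<N. seq_scale (x j) (unit_seq j) :: nat \<Rightarrow> 'k"
  have s_in: "?s N \<in> koethe w" for N
    using sub unit_seq_in_koethe closed(3) by (intro seq_space.subspace_sum) auto
  have ys: "y (?s N) = (\<Sum>j<N. x j * y (unit_seq j))" for N
  proof (induction N)
    case 0 then show ?case using linear_on_zero[OF lin closed(1)] by (simp only: lessThan_0 sum.empty)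
  next
    case (Suc N)
    have "y (?s N + seq_scale (x N) (unit_seq N)) = y (?s N) + y (seq_scale (x N) (unit_seq N))"
      using lin s_in[of N] closed(3)[OF unit_seq_in_koethe] unfolding linear_on_def by blast
    also have "y (seq_scale (x N) (unit_seq N)) = x N * y (unit_seq N)"
      using lin unit_seq_in_koethe unfolding linear_on_def by blast
    finally show ?case by (simp only: sum.lessThan_Suc Suc)
  qed
  have "norm (y x) \<le> M * koethe_norm w k x + C * koethe_norm w l (x - ?s N)" for N
  proof -
    have d: "x - ?s N \<in> koethe w" using x s_in by (intro closed(4))
    have "y (?s N + (x - ?s N)) = y (?s N) + y (x - ?s N)"
      using lin s_in[of N] d unfolding linear_on_def by blast
    then have "norm (y x) \<le> norm (y (?s N)) + norm (y (x - ?s N))"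
      using norm_triangle_ineq by simp
    also have "norm (y (?s N)) \<le> (\<Sum>j<N. norm (x j) * (M * w k j))"
      unfolding ys by (rule order_trans[OF norm_sum sum_mono]) (simp add: norm_mult le mult_left_mono)
    also have "\<dots> = M * (\<Sum>j<N. norm (x j) * w k j)"
      by (simp add: sum_distrib_left algebra_simps)
    also have "\<dots> \<le> M * koethe_norm w k x"
      unfolding koethe_norm_def using x M nonneg
      by (intro mult_left_mono sum_le_suminf koethe_summable) auto
    finally show ?thesis using C(2)[OF d] by linarith
  qed
  moreover have "(\<lambda>N. M * koethe_norm w k x + C * koethe_norm w l (x - ?s N))
      \<longlonglongrightarrow> M * koethe_norm w k x + C * 0"
    by (intro tendsto_intros sections_converge x)
  ultimately have "norm (y x) \<le> M * koethe_norm w k x + C * 0"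
    by (intro LIMSEQ_le_const) blast+
  also have "\<dots> \<le> M" using mult_left_mono[OF x(2) M] by simp
  finally show "norm (y x) \<le> M" .
qed

text \<open>
  The dual norms are weighted suprema of the values on unit sequences, so interpolation of the weights
  passes to them coordinate by coordinate. If a norm on the right is infinite and \<open>y\<close> is nonzero, the
  other factor is positive and nothing is claimed.
\<close>

lemma property_Omega_koethe:
  assumes "\<And>m. \<exists>q. \<forall>k. \<exists>\<theta>. 0 < \<theta> \<and> \<theta> < 1 \<and> (\<forall>n. w m n powr (1 - \<theta>) * w k n powr \<theta> \<le> w q n)"
  shows "property_Omega (seq_scale :: 'k::real_normed_field \<Rightarrow> _) (koethe w) (koethe_norm w)"
  unfolding property_Omega_def
proof
  fix m
  let ?d = "dual_norm (koethe w) (koethe_norm w) :: nat \<Rightarrow> ((nat \<Rightarrow> 'k) \<Rightarrow> 'k) \<Rightarrow> ennreal"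
  obtain q where q: "\<And>k. \<exists>\<theta>. 0 < \<theta> \<and> \<theta> < 1 \<and> (\<forall>n. w m n powr (1 - \<theta>) * w k n powr \<theta> \<le> w q n)"
    using assms by blast
  have "\<exists>C>0. \<exists>\<theta>. 0 < \<theta> \<and> \<theta> < 1 \<and> (\<forall>y\<in>top_dual (seq_scale :: 'k \<Rightarrow> _) (koethe w) (koethe_norm w).
      ?d q y \<le> ennreal C * epowr (?d m y) (1 - \<theta>) * epowr (?d k y) \<theta>)" for k
  proof -
    obtain \<theta> where \<theta>: "0 < \<theta>" "\<theta> < 1" and le: "\<And>n. w m n powr (1 - \<theta>) * w k n powr \<theta> \<le> w q n"
      using q by blast
    have "?d q y \<le> ennreal 1 * epowr (?d m y) (1 - \<theta>) * epowr (?d k y) \<theta>"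
      if y: "y \<in> top_dual (seq_scale :: 'k \<Rightarrow> _) (koethe w) (koethe_norm w)" for y
    proof (cases "\<forall>n. y (unit_seq n) = 0")
      case True
      then have "?d q y \<le> ennreal 0" using nonneg by (intro dual_norm_le[OF y]) auto
      then show ?thesis by simp
    next
      case False
      then obtain n0 where n0: "y (unit_seq n0) \<noteq> 0" by blast
      have lin: "linear_on seq_scale (*) (koethe w) y" using y by (simp add: top_dual_def)
      have dpos: "0 < ?d i y" for i
      proof -
        have "0 < ennreal (norm (y (unit_seq n0)) / w i n0)" using n0 pos by simp
        also have "\<dots> \<le> ?d i y" by (rule dual_norm_ge[OF lin])
        finally show ?thesis .
      qed
      have epos: "0 < epowr (?d i y) a" for i a
        using dpos[of i] enn2real_positive_iff[of "?d i y"] by (auto simp: epowr_def less_top)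
      show ?thesis
      proof (cases "?d m y = \<infinity> \<or> ?d k y = \<infinity>")
        case True
        then have "epowr (?d m y) (1 - \<theta>) * epowr (?d k y) \<theta> = \<infinity>"
        proof
          assume "?d m y = \<infinity>"
          then show ?thesis using epos[of k \<theta>] by (auto simp: epowr_def ennreal_top_mult)
        next
          assume "?d k y = \<infinity>"
          then show ?thesis using epos[of m "1 - \<theta>"] by (auto simp: epowr_def ennreal_mult_top)
        qed
        then show ?thesis by simp
      next
        case False
        define a b where "a = enn2real (?d m y)" and "b = enn2real (?d k y)"
        have ab: "?d m y = ennreal a" "?d k y = ennreal b" "0 \<le> a" "0 \<le> b"
          using False by (auto simp: a_def b_def less_top)
        have am: "norm (y (unit_seq n)) \<le> a * w m n" "norm (y (unit_seq n)) \<le> b * w k n" for n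
          using dual_norm_ge[OF lin, of n m] dual_norm_ge[OF lin, of n k] ab pos
          by (auto simp: pos_divide_le_eq)
        have "norm (y (unit_seq n)) \<le> a powr (1 - \<theta>) * b powr \<theta> * w q n" for n
        proof -
          have "norm (y (unit_seq n)) = norm (y (unit_seq n)) powr (1 - \<theta>) * norm (y (unit_seq n)) powr \<theta>"
            by (simp add: powr_add[symmetric])
          also have "\<dots> \<le> (a * w m n) powr (1 - \<theta>) * (b * w k n) powr \<theta>"
            using am \<theta> by (intro mult_mono powr_mono2) auto
          also have "\<dots> = a powr (1 - \<theta>) * b powr \<theta> * (w m n powr (1 - \<theta>) * w k n powr \<theta>)"
            using ab nonneg by (simp add: powr_mult)
          also have "\<dots> \<le> a powr (1 - \<theta>) * b powr \<theta> * w q n"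
            using le by (rule mult_left_mono) simp
          finally show ?thesis .
        qed
        then have "?d q y \<le> ennreal (a powr (1 - \<theta>) * b powr \<theta>)" by (rule dual_norm_le[OF y])
        also have "\<dots> = ennreal 1 * epowr (?d m y) (1 - \<theta>) * epowr (?d k y) \<theta>"
          unfolding ab using ab(3,4) by (simp add: epowr_def ennreal_mult)
        finally show ?thesis .
      qed
    qed
    then show ?thesis using \<theta> zero_less_one by blast
  qed
  then show "\<exists>q. \<forall>k. \<exists>C>0. \<exists>\<theta>. 0 < \<theta> \<and> \<theta> < 1 \<and> (\<forall>y\<in>top_dual (seq_scale :: 'k \<Rightarrow> _) (koethe w) (koethe_norm w).
      ?d q y \<le> ennreal C * epowr (?d m y) (1 - \<theta>) * epowr (?d k y) \<theta>)" by blast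
qed

end

section \<open>Kolmogorov diameters of Koethe spaces\<close>

text \<open>
  In the lower bound for the diameters this supplies a functional that lives on \<open>n + 1\<close> coordinates and annihilates a given space of
  dimension at most \<open>n\<close>.
\<close>

lemma homogeneous_system_solution:
  fixes B :: "('i \<Rightarrow> 'a::field) set"
  assumes "finite B" "finite S" "card B < card S"
  shows "\<exists>c. (\<exists>m\<in>S. c m \<noteq> 0) \<and> (\<forall>b\<in>B. (\<Sum>m\<in>S. c m * b m) = 0)"
  using assms
proof (induction "card B" arbitrary: B S rule: less_induct)
  case less
  show ?case
  proof (cases "\<forall>b\<in>B. \<forall>m\<in>S. b m = 0")
    case True
    obtain m where "m \<in> S" using less.prems by (metis card.empty ex_in_conv not_less_zero)
    then show ?thesis using True by (intro exI[of _ "\<lambda>_. 1"]) auto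
  next
    case False
    then obtain b m where bm: "b \<in> B" "m \<in> S" "b m \<noteq> 0" by blast
    \<comment> \<open>Gaussian elimination with pivot \<open>b m\<close>.\<close>
    define B' where "B' = (\<lambda>a i. a i - a m / b m * b i) ` (B - {b})"
    have "card B' \<le> card (B - {b})"
      unfolding B'_def by (rule card_image_le) (simp add: less.prems)
    moreover have "card (B - {b}) < card B" using less.prems bm by (intro card_Diff1_less)
    moreover have "card (S - {m}) = card S - 1" "card (B - {b}) = card B - 1"
      using less.prems bm by simp_all
    ultimately have "card B' < card B" "card B' < card (S - {m})" using less.prems by linarith+
    moreover have "finite B'" "finite (S - {m})" using less.prems by (simp_all add: B'_def)
    ultimately obtain c where c: "\<exists>i\<in>S - {m}. c i \<noteq> 0"
      "\<And>a. a \<in> B' \<Longrightarrow> (\<Sum>i\<in>S - {m}. c i * a i) = 0"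
      using less.hyps[of B' "S - {m}"] by blast
    define c' where "c' = c(m := - (\<Sum>i\<in>S - {m}. c i * b i) / b m)"
    have sum_c': "(\<Sum>i\<in>S. c' i * a i)
        = (\<Sum>i\<in>S - {m}. c i * a i) - a m / b m * (\<Sum>i\<in>S - {m}. c i * b i)" for a
    proof -
      have "(\<Sum>i\<in>S. c' i * a i) = c' m * a m + (\<Sum>i\<in>S - {m}. c' i * a i)"
        by (rule sum.remove) (use less.prems bm in auto)
      also have "(\<Sum>i\<in>S - {m}. c' i * a i) = (\<Sum>i\<in>S - {m}. c i * a i)"
        by (rule sum.cong) (auto simp: c'_def)
      finally show ?thesis by (simp add: c'_def)
    qed
    have "(\<Sum>i\<in>S. c' i * a i) = 0" if a: "a \<in> B" for a
    proof (cases "a = b")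
      case True
      then show ?thesis using bm by (simp add: sum_c')
    next
      case False
      then have "(\<Sum>i\<in>S - {m}. c i * (a i - a m / b m * b i)) = 0"
        using a by (intro c(2)) (auto simp: B'_def)
      moreover have "(\<Sum>i\<in>S - {m}. c i * (a i - a m / b m * b i))
          = (\<Sum>i\<in>S - {m}. c i * a i) - (\<Sum>i\<in>S - {m}. a m / b m * (c i * b i))"
        unfolding sum_subtractf[symmetric] by (rule sum.cong) (simp_all add: algebra_simps)
      ultimately show ?thesis by (simp add: sum_c' sum_distrib_left)
    qed
    moreover have "\<exists>i\<in>S. c' i \<noteq> 0" using c(1) by (auto simp: c'_def)
    ultimately show ?thesis by blast
  qed
qed

context koethe_matrix
begin

text \<open>
  For norms of \<open>l\<^sub>1\<close> type the lower bound is a matter of linear duality: a functional \<open>\<phi>\<close> on the coordinates in \<open>S\<close>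
  that annihilates \<open>L\<close> does not distinguish a point of the larger ball from its approximation, and
  \<open>\<phi>\<close> attains its norm at a multiple of a unit sequence.
\<close>

lemma kolmogorov_diameter_ge:
  assumes "finite S" "n < card S" "p \<le> q" "0 < r"
    and ratio: "\<And>m. m \<in> S \<Longrightarrow> r * w q m \<le> w p m"
  shows "r \<le> kolmogorov_diameter (seq_scale :: 'k::real_normed_field \<Rightarrow> _) (koethe w) n
      (unit_ball (koethe w) (koethe_norm w) q) (unit_ball (koethe w) (koethe_norm w) p)"
  unfolding kolmogorov_diameter_def
proof (rule cInf_greatest)
  interpret seminormed_space "seq_scale :: 'k \<Rightarrow> _" "koethe w" "koethe_norm w"
    by (rule seminormed_space_koethe)
  let ?U = "\<lambda>k. unit_ball (koethe w) (koethe_norm w) k :: (nat \<Rightarrow> 'k) set"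
  let ?T = "{t. 0 < t \<and> (\<exists>L. module.subspace (seq_scale :: 'k \<Rightarrow> _) L \<and> L \<subseteq> koethe w \<and>
      (\<exists>B. finite B \<and> L \<subseteq> module.span seq_scale B) \<and> vector_space.dim seq_scale L \<le> n \<and>
      ?U q \<subseteq> {seq_scale (of_real t) u + v |u v. u \<in> ?U p \<and> v \<in> L})}"
  have "1 \<in> ?T"
  proof (intro CollectI conjI exI[of _ "{0}"] exI[of _ "{}"])
    have "?U q \<subseteq> ?U p"
      using seminorm_mono \<open>p \<le> q\<close> by (fastforce simp: unit_ball_def)
    then show "?U q \<subseteq> {seq_scale (of_real 1) u + v |u v. u \<in> ?U p \<and> v \<in> {0}}"
      by (auto simp: seq_scale_def)
    have "seq_space.dim ({0} :: (nat \<Rightarrow> 'k) set) \<le> card ({} :: (nat \<Rightarrow> 'k) set)"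
      by (rule seq_space.dim_le_card) auto
    then show "seq_space.dim ({0} :: (nat \<Rightarrow> 'k) set) \<le> n" by simp
  qed (auto simp: closed seq_space.subspace_single_0)
  then show "?T \<noteq> {}" by blast
  fix t assume "t \<in> ?T"
  then obtain L where t: "0 < t" and L: "seq_space.subspace L" "seq_space.dim L \<le> n"
    and Lfin: "\<exists>B. finite B \<and> L \<subseteq> seq_space.span B"
    and cover: "?U q \<subseteq> {seq_scale (of_real t) u + v |u v. u \<in> ?U p \<and> v \<in> L}"
    by blast
  obtain B where B: "B \<subseteq> L" "seq_space.independent B" "L \<subseteq> seq_space.span B" "card B = seq_space.dim L"
    using seq_space.basis_exists by blast
  have "finite B"
    using seq_space.independent_span_bound[OF _ B(2)] Lfin B(1) by (meson order_trans)
  then obtain c where c: "\<exists>m\<in>S. c m \<noteq> 0" "\<And>b. b \<in> B \<Longrightarrow> (\<Sum>m\<in>S. c m * b m) = 0"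
    using homogeneous_system_solution[of B S] assms(1,2) B(4) L(2) by fastforce
  define \<phi> where "\<phi> x = (\<Sum>m\<in>S. c m * x m)" for x
  have \<phi>_lin: "\<phi> (x + y) = \<phi> x + \<phi> y" "\<phi> (seq_scale a x) = a * \<phi> x" for x y a
    by (simp_all add: \<phi>_def distrib_left sum.distrib seq_scale_apply sum_distrib_left mult_ac)
  have "seq_space.subspace {x. \<phi> x = 0}"
    unfolding seq_space.subspace_def by (simp add: \<phi>_lin) (simp add: \<phi>_def)
  then have "seq_space.span B \<subseteq> {x. \<phi> x = 0}"
    using c(2) by (intro seq_space.span_minimal) (auto simp: \<phi>_def)
  then have \<phi>L: "\<phi> v = 0" if "v \<in> L" for v using that B(3) by blast
  \<comment> \<open>On the coordinates in \<open>S\<close> the norm of \<open>\<phi>\<close> with respect to the norm \<open>p\<close> is the maximum \<open>M\<close>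
     of \<open>norm (c m) / w p m\<close>; it is attained at a multiple of a unit sequence.\<close>
  define M where "M = Max ((\<lambda>m. norm (c m) / w p m) ` S)"
  have "S \<noteq> {}" using assms(2) by auto
  then have "M \<in> (\<lambda>m. norm (c m) / w p m) ` S"
    unfolding M_def using assms(1) by (intro Max_in) auto
  then obtain m0 where m0: "m0 \<in> S" "M = norm (c m0) / w p m0" by blast
  have M: "norm (c m) \<le> M * w p m" if "m \<in> S" for m
  proof -
    have "norm (c m) / w p m \<le> M" unfolding M_def using assms(1) that by (intro Max_ge) auto
    then show ?thesis using pos[of p m] by (simp add: pos_divide_le_eq)
  qed
  have Mpos: "0 < M"
  proof -
    obtain m where m: "m \<in> S" "c m \<noteq> 0" using c(1) by blast
    then have "0 < M * w p m" using M[OF m(1)] by (metis order.strict_trans2 zero_less_norm_iff)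
    then show ?thesis using nonneg[of p m] by (simp add: zero_less_mult_iff)
  qed
  let ?a = "of_real (1 / w q m0) :: 'k"
  have a: "norm ?a = 1 / w q m0" using pos[of q m0] by (simp only: norm_of_real) simp
  have "koethe_norm w q (seq_scale ?a (unit_seq m0)) = 1"
    unfolding seminorm(3)[OF unit_seq_in_koethe] a using pos[of q m0] by (simp add: koethe_norm_unit_seq)
  then have "seq_scale ?a (unit_seq m0) \<in> ?U q"
    unfolding unit_ball_def using closed(3)[OF unit_seq_in_koethe] by simp
  then obtain u v where uv: "seq_scale ?a (unit_seq m0) = seq_scale (of_real t) u + v" "u \<in> ?U p" "v \<in> L"
    using cover by blast
  have "\<phi> (unit_seq m0) = c m0"
    using m0(1) assms(1) by (simp add: \<phi>_def unit_seq_def if_distrib cong: if_cong)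
  then have "?a * c m0 = of_real t * \<phi> u"
    using arg_cong[OF uv(1), of \<phi>] \<phi>L[OF uv(3)] by (simp add: \<phi>_lin)
  then have \<phi>u: "norm (c m0) / w q m0 = t * norm (\<phi> u)"
    using arg_cong[of _ _ norm] a t by (metis abs_of_pos divide_inverse inverse_eq_divide mult.commute norm_mult norm_of_real)
  have "norm (\<phi> u) \<le> M"
  proof -
    have u: "u \<in> koethe w" "koethe_norm w p u \<le> 1" using uv(2) by (auto simp: unit_ball_def)
    have "norm (\<phi> u) \<le> (\<Sum>m\<in>S. M * w p m * norm (u m))"
      unfolding \<phi>_def using M by (intro order_trans[OF norm_sum] sum_mono) (simp add: norm_mult mult_right_mono)
    also have "\<dots> = M * (\<Sum>m\<in>S. norm (u m) * w p m)"
      by (simp add: sum_distrib_left mult_ac)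
    also have "(\<Sum>m\<in>S. norm (u m) * w p m) \<le> koethe_norm w p u"
      unfolding koethe_norm_def using assms(1) nonneg by (intro sum_le_suminf koethe_summable u) auto
    finally show ?thesis using u(2) Mpos mult_left_mono[of _ 1 M]
      by (smt (verit) mult_cancel_left1 mult_left_mono)
  qed
  then have "t * norm (\<phi> u) \<le> M * t" using t by (simp add: mult.commute)
  moreover have "M * (w p m0 / w q m0) = t * norm (\<phi> u)"
    unfolding \<phi>u[symmetric] using m0(2) pos[of p m0] by simp
  ultimately have "M * (w p m0 / w q m0) \<le> M * t" by simp
  then have "w p m0 / w q m0 \<le> t" using mult_le_cancel_left_pos[OF Mpos] by blast
  moreover have "r \<le> w p m0 / w q m0" using ratio[OF m0(1)] pos[of q m0] by (simp add: pos_le_divide_eq)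
  ultimately show "r \<le> t" by simp
qed

text \<open>
  The span of the first \<open>n\<close> unit sequences approximates well enough. The lower bound 0 lets the
  diameter stand for its absolute value when it multiplies a null sequence.
\<close>

lemma kolmogorov_diameter_le:
  assumes r: "0 < r" and ratio: "\<And>m. n \<le> m \<Longrightarrow> w p m \<le> r * w q m"
  shows "kolmogorov_diameter (seq_scale :: 'k::real_normed_field \<Rightarrow> _) (koethe w) n
      (unit_ball (koethe w) (koethe_norm w) q) (unit_ball (koethe w) (koethe_norm w) p) \<in> {0..r}"
proof -
  interpret seminormed_space "seq_scale :: 'k \<Rightarrow> _" "koethe w" "koethe_norm w"
    by (rule seminormed_space_koethe)
  let ?U = "\<lambda>k. unit_ball (koethe w) (koethe_norm w) k :: (nat \<Rightarrow> 'k) set"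
  let ?T = "{t. 0 < t \<and> (\<exists>L. module.subspace (seq_scale :: 'k \<Rightarrow> _) L \<and> L \<subseteq> koethe w \<and>
      (\<exists>B. finite B \<and> L \<subseteq> module.span seq_scale B) \<and> vector_space.dim seq_scale L \<le> n \<and>
      ?U q \<subseteq> {seq_scale (of_real t) u + v |u v. u \<in> ?U p \<and> v \<in> L})}"
  let ?B = "unit_seq ` {..<n} :: (nat \<Rightarrow> 'k) set"
  have "r \<in> ?T"
  proof (rule CollectI, rule conjI[OF r], rule exI[of _ "seq_space.span ?B"], intro conjI subsetI)
    show "\<exists>B. finite B \<and> seq_space.span ?B \<subseteq> seq_space.span B"
      by (rule exI[of _ ?B]) simp
    show "seq_space.dim (seq_space.span ?B) \<le> n"
      using seq_space.dim_le_card[of "seq_space.span ?B" ?B] card_image_le[of "{..<n}" "unit_seq :: nat \<Rightarrow> nat \<Rightarrow> 'k"]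
      by simp
    show "x \<in> koethe w" if "x \<in> seq_space.span ?B" for x
      using that seq_space.span_minimal[OF _ sub, of ?B] unit_seq_in_koethe by blast
    fix x :: "nat \<Rightarrow> 'k" assume "x \<in> ?U q"
    then have x: "x \<in> koethe w" "koethe_norm w q x \<le> 1" by (auto simp: unit_ball_def)
    define v where "v = (\<lambda>m. if m < n then x m else 0)"
    define u where "u = seq_scale (of_real (1 / r)) (x - v)"
    have "v \<in> seq_space.span ?B"
      unfolding v_def restriction_eq_sum_unit_seq
      by (intro seq_space.span_sum seq_space.span_scale seq_space.span_base) auto
    moreover have "u \<in> ?U p"
    proof -
      have "x - v \<in> koethe w" by (rule dominated_in_koethe[OF x(1)]) (auto simp: v_def)
      then have u: "u \<in> koethe w" unfolding u_def by (rule closed(3))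
      have "norm (u m) * w p m \<le> norm (x m) * w q m" for m
      proof (cases "m < n")
        case True then show ?thesis by (simp add: u_def v_def seq_scale_apply nonneg)
      next
        case False
        have "norm (u m) = norm (x m) / r"
          using False r by (simp add: u_def v_def seq_scale_apply norm_divide)
        then have "norm (u m) * w p m \<le> norm (x m) / r * (r * w q m)"
          using mult_left_mono[OF ratio[of m] norm_ge_zero, of "u m"] False by (simp only: not_less)
        then show ?thesis using r by simp
      qed
      then have "koethe_norm w p u \<le> koethe_norm w q x"
        unfolding koethe_norm_def by (intro suminf_le koethe_summable u x)
      then show ?thesis using u x(2) by (simp add: unit_ball_def)
    qed
    moreover have "x = seq_scale (of_real r) u + v"
      using r by (simp add: u_def fun_eq_iff seq_scale_apply)
    ultimately show "x \<in> {seq_scale (of_real r) u + v |u v. u \<in> ?U p \<and> v \<in> seq_space.span ?B}" by blast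
  qed (rule seq_space.subspace_span)
  moreover have "bdd_below ?T" by (rule bdd_belowI[of _ 0]) auto
  ultimately have "Inf ?T \<le> r" by (rule cInf_lower)
  moreover have "0 \<le> Inf ?T" using \<open>r \<in> ?T\<close> by (intro cInf_greatest) auto
  ultimately show ?thesis unfolding kolmogorov_diameter_def by simp
qed

end

section \<open>Sequences of subexponential growth and power series spaces\<close>

text \<open>
  This is the space \<open>\<Lambda>\<^sub>1(\<alpha>)\<close> with sup-norms instead of sums, and it is the diametral dimension of
  \<open>\<Lambda>\<^sub>1(\<alpha>)\<close> for every exponent sequence.
\<close>

definition subexponential :: "(nat \<Rightarrow> real) \<Rightarrow> (nat \<Rightarrow> 'k::real_normed_field) set" where
  "subexponential \<alpha> = {t. \<forall>\<delta>>0. (\<lambda>n. norm (t n) * exp (- (\<delta> * \<alpha> n))) \<longlonglongrightarrow> 0}"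

lemma subexponentialD:
  "t \<in> subexponential \<alpha> \<Longrightarrow> 0 < \<delta> \<Longrightarrow> (\<lambda>n. norm (t n) * exp (- (\<delta> * \<alpha> n))) \<longlonglongrightarrow> 0"
  by (simp add: subexponential_def)

lemma subexponential_bounded:
  assumes "t \<in> subexponential \<alpha>" "0 < \<delta>"
  shows "\<exists>C. \<forall>n. norm (t n) * exp (- (\<delta> * \<alpha> n)) \<le> C"
proof -
  have "Bseq (\<lambda>n. norm (t n) * exp (- (\<delta> * \<alpha> n)))"
    using subexponentialD[OF assms] by (intro convergent_imp_Bseq convergentI)
  then obtain C where "\<And>n. norm (norm (t n) * exp (- (\<delta> * \<alpha> n))) \<le> C"
    unfolding Bseq_def by blast
  then show ?thesis by (intro exI[of _ C]) simp
qed

lemma exp_neg_exponent_tendsto_0: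
  assumes "exponent_sequence \<alpha>" "0 < \<delta>"
  shows "(\<lambda>n. exp (- (\<delta> * \<alpha> n))) \<longlonglongrightarrow> 0"
proof -
  have "filterlim (\<lambda>n. \<delta> * \<alpha> n) at_top sequentially"
    using assms by (intro filterlim_tendsto_pos_mult_at_top[of _ \<delta>]) (auto simp: exponent_sequence_def)
  then have "filterlim (\<lambda>n. - (\<delta> * \<alpha> n)) at_bot sequentially"
    by (simp add: filterlim_uminus_at_bot)
  then show ?thesis by (rule filterlim_compose[OF exp_at_bot])
qed

lemma Lambda1_subset_subexponential: "Lambda1 \<alpha> \<subseteq> subexponential \<alpha>" if "\<And>n. 0 \<le> \<alpha> n"
proof
  fix t :: "nat \<Rightarrow> 'a" assume t: "t \<in> Lambda1 \<alpha>"
  show "t \<in> subexponential \<alpha>"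
    unfolding subexponential_def
  proof (intro CollectI allI impI)
    fix \<delta> :: real assume "0 < \<delta>"
    then obtain k where k: "1 / real (Suc k) < \<delta>" using nat_approx_posE by blast
    have "summable (\<lambda>n. norm (t n) * exp (- (\<alpha> n / real (Suc k))))" using t by (simp add: Lambda1_def)
    then have lim: "(\<lambda>n. norm (t n) * exp (- (\<alpha> n / real (Suc k)))) \<longlonglongrightarrow> 0"
      by (rule summable_LIMSEQ_zero)
    have le: "norm (t n) * exp (- (\<delta> * \<alpha> n)) \<le> norm (t n) * exp (- (\<alpha> n / real (Suc k)))" for n
      using mult_right_mono[of "1 / real (Suc k)" \<delta> "\<alpha> n"] k that[of n] by (simp add: mult_left_mono)
    show "(\<lambda>n. norm (t n) * exp (- (\<delta> * \<alpha> n))) \<longlonglongrightarrow> 0"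
      by (rule tendsto_sandwich[OF _ _ tendsto_const lim]) (use le in auto)
  qed
qed

text \<open>
  The hypothesis is nuclearity of \<open>\<Lambda>\<^sub>1(\<alpha>)\<close>; it lets half of the exponent be spent on summability.
\<close>

lemma subexponential_subset_Lambda1:
  assumes "\<And>\<delta>. 0 < \<delta> \<Longrightarrow> summable (\<lambda>n. exp (- (\<delta> * \<alpha> n)))"
  shows "(subexponential \<alpha> :: (nat \<Rightarrow> 'k::real_normed_field) set) \<subseteq> Lambda1 \<alpha>"
proof
  fix t :: "nat \<Rightarrow> 'k" assume t: "t \<in> subexponential \<alpha>"
  have "summable (\<lambda>n. norm (t n) * exp (- (\<alpha> n / real (Suc k))))" for k
  proof -
    let ?d = "1 / (2 * real (Suc k))"
    have "0 < ?d" by simp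
    then obtain C where C: "\<And>n. norm (t n) * exp (- (?d * \<alpha> n)) \<le> C"
      using subexponential_bounded[OF t] by blast
    have "summable (\<lambda>n. C * exp (- (?d * \<alpha> n)))"
      by (intro summable_mult assms) simp
    then show ?thesis
    proof (rule summable_comparison_test'[of _ 0])
      fix n
      have "a / c = 1 / (2 * c) * a + 1 / (2 * c) * a" if "c \<noteq> 0" for a c :: real
        using that by (simp add: field_simps)
      from this[of "real (Suc k)" "\<alpha> n"]
      have "exp (- (\<alpha> n / real (Suc k))) = exp (- (?d * \<alpha> n)) * exp (- (?d * \<alpha> n))"
        unfolding exp_add[symmetric] by simp
      then have "norm (norm (t n) * exp (- (\<alpha> n / real (Suc k))))
          = norm (t n) * exp (- (?d * \<alpha> n)) * exp (- (?d * \<alpha> n))"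
        by (simp only: real_norm_def abs_mult abs_norm_cancel abs_exp_cancel mult.assoc)
      also have "\<dots> \<le> C * exp (- (?d * \<alpha> n))" by (intro mult_right_mono C) simp
      finally show "norm (norm (t n) * exp (- (\<alpha> n / real (Suc k)))) \<le> C * exp (- (?d * \<alpha> n))" .
    qed
  qed
  then show "t \<in> Lambda1 \<alpha>" by (simp add: Lambda1_def)
qed

lemma subexponential_subset_Lambda_inf_dual: "subexponential \<alpha> \<subseteq> Lambda_inf_dual \<alpha>"
proof
  fix t :: "nat \<Rightarrow> 'a" assume "t \<in> subexponential \<alpha>"
  then obtain C where "\<And>n. norm (t n) * exp (- (1 * \<alpha> n)) \<le> C"
    using subexponential_bounded zero_less_one by metis
  then have "bdd_above (range (\<lambda>n. norm (t n) * exp (- (real 1 * \<alpha> n))))"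
    by (intro bdd_aboveI2[of _ _ C]) simp
  then show "t \<in> Lambda_inf_dual \<alpha>" unfolding Lambda_inf_dual_def by blast
qed

text \<open>
  Sequences of subexponential growth determine the exponents up to equivalence. If \<open>\<epsilon>\<close> were not
  bounded by a multiple of \<open>\<alpha> + 1\<close>, there would be a sequence of subexponential growth in \<open>\<epsilon>\<close>, supported
  where \<open>\<epsilon>\<close> is much larger than \<open>\<alpha>\<close>, that grows faster there than every exponential of \<open>\<alpha>\<close>.
\<close>

lemma exponent_comparison:
  assumes \<epsilon>: "exponent_sequence \<epsilon>" and \<alpha>: "exponent_sequence \<alpha>"
    and sub: "(subexponential \<epsilon> :: (nat \<Rightarrow> 'k::real_normed_field) set) \<subseteq> Lambda_inf_dual \<alpha>"
  shows "\<exists>C>0. \<forall>n. \<epsilon> n \<le> C * (\<alpha> n + 1)"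
proof (rule ccontr)
  assume no: "\<not> ?thesis"
  have \<alpha>0: "0 \<le> \<alpha> n" and \<epsilon>0: "0 \<le> \<epsilon> n" for n using \<epsilon> \<alpha> by (auto simp: exponent_sequence_def)
  have "\<exists>n. (real k + 1)\<^sup>2 * (\<alpha> n + 1) < \<epsilon> n" for k
  proof (rule ccontr)
    assume "\<not> ?thesis"
    then have "\<forall>n. \<epsilon> n \<le> (real k + 1)\<^sup>2 * (\<alpha> n + 1)" by (simp add: not_less)
    moreover have "0 < (real k + 1)\<^sup>2" by (intro zero_less_power) simp
    ultimately show False using no by blast
  qed
  then obtain \<nu> where \<nu>: "\<And>k. (real k + 1)\<^sup>2 * (\<alpha> (\<nu> k) + 1) < \<epsilon> (\<nu> k)" by metis
  \<comment> \<open>The geometric mean of \<open>\<epsilon>\<close> and \<open>\<alpha> + 1\<close> along \<open>\<nu>\<close> is small against \<open>\<epsilon>\<close> and large against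
     \<open>\<alpha>\<close>.\<close>
  let ?g = "\<lambda>n. sqrt (\<epsilon> n * (\<alpha> n + 1))"
  define t :: "nat \<Rightarrow> 'k" where "t n = (if n \<in> range \<nu> then of_real (exp (?g n)) else 0)" for n
  have "t \<in> subexponential \<epsilon>"
    unfolding subexponential_def
  proof (intro CollectI allI impI)
    fix \<delta> :: real assume \<delta>: "0 < \<delta>"
    have "0 < \<delta> / 2" using \<delta> by simp
    then obtain K where K: "1 / real (Suc K) < \<delta> / 2" by (rule nat_approx_posE)
    have small: "norm (t n) * exp (- (\<delta> * \<epsilon> n)) \<le> exp (- (\<delta> / 2 * \<epsilon> n))" if n: "n \<notin> \<nu> ` {..<K}" for n
    proof (cases "n \<in> range \<nu>")
      case False
      then show ?thesis by (simp add: t_def)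
    next
      case True
      then obtain k where k: "n = \<nu> k" "K \<le> k" using n by force
      have "\<alpha> n + 1 \<le> \<epsilon> n / (real k + 1)\<^sup>2"
        using \<nu>[of k] by (simp add: k(1) field_simps)
      also have "\<dots> \<le> \<epsilon> n / (real K + 1)\<^sup>2"
        using k(2) \<epsilon>0 by (intro divide_left_mono power_mono) auto
      finally have "\<epsilon> n * (\<alpha> n + 1) \<le> \<epsilon> n * (\<epsilon> n / (real K + 1)\<^sup>2)"
        using \<epsilon>0 by (rule mult_left_mono)
      also have "\<dots> = (\<epsilon> n / (real K + 1))\<^sup>2" by (simp add: power2_eq_square)
      finally have "?g n \<le> \<epsilon> n / (real K + 1)"
        using \<epsilon>0[of n] by (intro real_le_lsqrt) auto
      also have "\<dots> \<le> \<delta> / 2 * \<epsilon> n"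
        using mult_right_mono[OF less_imp_le[OF K] \<epsilon>0[of n]] by (simp add: add.commute)
      finally have "exp (?g n) * exp (- (\<delta> * \<epsilon> n)) \<le> exp (- (\<delta> / 2 * \<epsilon> n))"
        unfolding exp_add[symmetric] by simp
      then show ?thesis using True by (simp add: t_def)
    qed
    have "finite (\<nu> ` {..<K})" by simp
    then obtain N where "\<nu> ` {..<K} \<subseteq> {..<N}" using finite_nat_iff_bounded by blast
    then have "norm (t n) * exp (- (\<delta> * \<epsilon> n)) \<le> exp (- (\<delta> / 2 * \<epsilon> n))" if "n \<ge> N" for n
      using that by (intro small) auto
    then have ev: "\<forall>\<^sub>F n in sequentially. norm (t n) * exp (- (\<delta> * \<epsilon> n)) \<le> exp (- (\<delta> / 2 * \<epsilon> n))"
      by (rule eventually_sequentiallyI)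
    show "(\<lambda>n. norm (t n) * exp (- (\<delta> * \<epsilon> n))) \<longlonglongrightarrow> 0"
    proof (rule tendsto_sandwich[OF _ ev tendsto_const])
      show "(\<lambda>n. exp (- (\<delta> / 2 * \<epsilon> n))) \<longlonglongrightarrow> 0"
        by (rule exp_neg_exponent_tendsto_0[OF \<epsilon>]) (simp add: \<delta>)
    qed simp
  qed
  then have "t \<in> Lambda_inf_dual \<alpha>" using sub by blast
  then obtain j :: nat where "bdd_above (range (\<lambda>n. norm (t n) * exp (- (real j * \<alpha> n))))"
    unfolding Lambda_inf_dual_def by blast
  then obtain M where M: "\<And>n. norm (t n) * exp (- (real j * \<alpha> n)) \<le> M"
    unfolding bdd_above_def by blast
  have "real k + 1 - real j \<le> M" if "j \<le> k" for k
  proof -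
    let ?n = "\<nu> k"
    have "(real k + 1)\<^sup>2 * (\<alpha> ?n + 1) * (\<alpha> ?n + 1) \<le> \<epsilon> ?n * (\<alpha> ?n + 1)"
      using \<alpha>0[of ?n] \<nu>[of k] by (intro mult_right_mono) auto
    then have "((real k + 1) * (\<alpha> ?n + 1))\<^sup>2 \<le> \<epsilon> ?n * (\<alpha> ?n + 1)"
      by (simp add: power2_eq_square mult_ac)
    then have "(real k + 1) * (\<alpha> ?n + 1) \<le> ?g ?n" by (rule real_le_rsqrt)
    moreover have "real k + 1 - real j \<le> (real k + 1) * (\<alpha> ?n + 1) - real j * \<alpha> ?n"
      using mult_nonneg_nonneg[of "real k + 1 - real j" "\<alpha> ?n"] \<alpha>0[of ?n] that
      by (simp add: algebra_simps)
    ultimately have "real k + 1 - real j \<le> ?g ?n - real j * \<alpha> ?n" by linarith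
    also have "\<dots> \<le> exp (?g ?n - real j * \<alpha> ?n)"
      using exp_ge_add_one_self[of "?g ?n - real j * \<alpha> ?n"] by linarith
    also have "\<dots> = norm (t ?n) * exp (- (real j * \<alpha> ?n))"
      by (simp add: t_def exp_diff exp_minus divide_inverse)
    also have "\<dots> \<le> M" by (rule M)
    finally show ?thesis .
  qed
  from this[of "j + nat \<lceil>M\<rceil>"] show False by simp linarith
qed

lemma Lambda_inf_dual_mono:
  assumes "\<exists>C>0. \<forall>n. \<epsilon> n \<le> C * (\<alpha> n + 1)" and \<alpha>: "\<And>n. 0 \<le> \<alpha> n"
  shows "Lambda_inf_dual \<epsilon> \<subseteq> Lambda_inf_dual \<alpha>"
proof
  fix t :: "nat \<Rightarrow> 'a" assume "t \<in> Lambda_inf_dual \<epsilon>"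
  then obtain k :: nat where "bdd_above (range (\<lambda>n. norm (t n) * exp (- (real k * \<epsilon> n))))"
    unfolding Lambda_inf_dual_def by blast
  then obtain M where M: "\<And>n. norm (t n) * exp (- (real k * \<epsilon> n)) \<le> M"
    unfolding bdd_above_def by blast
  obtain C where C: "0 < C" "\<And>n. \<epsilon> n \<le> C * (\<alpha> n + 1)" using assms(1) by blast
  obtain j :: nat where j: "real k * C \<le> real j" using real_arch_simple by blast
  have "norm (t n) * exp (- (real j * \<alpha> n)) \<le> M * exp (real j)" for n
  proof -
    have "real k * \<epsilon> n \<le> real k * (C * (\<alpha> n + 1))" by (intro mult_left_mono C) simp
    also have "\<dots> = real k * C * (\<alpha> n + 1)" by simp
    also have "\<dots> \<le> real j * (\<alpha> n + 1)" using j \<alpha>[of n] by (intro mult_right_mono) auto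
    finally have "exp (- (real j * \<alpha> n)) \<le> exp (- (real k * \<epsilon> n)) * exp (real j)"
      unfolding exp_add[symmetric] by (simp add: algebra_simps)
    then have "norm (t n) * exp (- (real j * \<alpha> n)) \<le> norm (t n) * (exp (- (real k * \<epsilon> n)) * exp (real j))"
      by (rule mult_left_mono) simp
    also have "\<dots> \<le> M * exp (real j)"
      using mult_right_mono[OF M[of n], of "exp (real j)"] by (simp add: mult.assoc)
    finally show ?thesis .
  qed
  then have "bdd_above (range (\<lambda>n. norm (t n) * exp (- (real j * \<alpha> n))))" by (rule bdd_aboveI2)
  then show "t \<in> Lambda_inf_dual \<alpha>" unfolding Lambda_inf_dual_def by blast
qed

lemma (in koethe_matrix) subexponential_subset_diametral_dimension:
  assumes \<alpha>: "incseq \<alpha>" and ratio: "\<And>k. \<exists>c>0. \<forall>m. w k m \<le> exp (- (c * \<alpha> m)) * w (Suc k) m"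
  shows "(subexponential \<alpha> :: (nat \<Rightarrow> 'k::real_normed_field) set)
    \<subseteq> diametral_dimension seq_scale (koethe w) (koethe_norm w)"
proof
  fix t :: "nat \<Rightarrow> 'k" assume t: "t \<in> subexponential \<alpha>"
  let ?d = "\<lambda>n q k. kolmogorov_diameter (seq_scale :: 'k \<Rightarrow> _) (koethe w) n
    (unit_ball (koethe w) (koethe_norm w) q) (unit_ball (koethe w) (koethe_norm w) k)"
  have "(\<lambda>n. t n * of_real (?d n (Suc k) k)) \<longlonglongrightarrow> 0" for k
  proof -
    obtain c where c: "0 < c" "\<And>m. w k m \<le> exp (- (c * \<alpha> m)) * w (Suc k) m" using ratio by blast
    have d: "?d n (Suc k) k \<in> {0..exp (- (c * \<alpha> n))}" for n
    proof (rule kolmogorov_diameter_le)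
      fix m assume "n \<le> m"
      then have "exp (- (c * \<alpha> m)) \<le> exp (- (c * \<alpha> n))" using c(1) \<alpha> by (simp add: incseq_def)
      from mult_right_mono[OF this nonneg]
      show "w k m \<le> exp (- (c * \<alpha> n)) * w (Suc k) m"
        by (rule order_trans[OF c(2)])
    qed simp
    have "norm (t n * of_real (?d n (Suc k) k)) \<le> norm (t n) * exp (- (c * \<alpha> n))" for n
      using d[of n] by (simp add: norm_mult mult_left_mono)
    then have "\<forall>\<^sub>F n in sequentially.
        norm (t n * of_real (?d n (Suc k) k)) \<le> norm (t n) * exp (- (c * \<alpha> n))"
      by (intro always_eventually allI)
    moreover have "(\<lambda>n. norm (t n) * exp (- (c * \<alpha> n))) \<longlonglongrightarrow> 0"
      using t c(1) by (simp add: subexponential_def)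
    ultimately show ?thesis by (rule Lim_null_comparison)
  qed
  then show "t \<in> diametral_dimension seq_scale (koethe w) (koethe_norm w)"
    unfolding diametral_dimension_def by blast
qed

text \<open>
  Stated for all \<open>r\<close> at once at a given \<open>n\<close>, so that two null sequences can be combined when \<open>n\<close> decides
  which of them has the large factor.
\<close>

lemma null_sequence_of_diameter_bound:
  fixes t :: "nat \<Rightarrow> 'k::real_normed_field"
  assumes "(\<lambda>n. t n * of_real (d n)) \<longlonglongrightarrow> 0" "0 < e"
  shows "\<forall>\<^sub>F n in sequentially. \<forall>r. 0 \<le> r \<and> r \<le> d n \<longrightarrow> norm (t n) * r < e"
proof -
  have "\<forall>\<^sub>F n in sequentially. norm (t n * of_real (d n)) < e"
    using order_tendstoD(2)[OF tendsto_norm_zero[OF assms(1)] assms(2)] .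
  then show ?thesis
  proof eventually_elim
    case (elim n)
    show ?case
    proof (intro allI impI)
      fix r assume "0 \<le> r \<and> r \<le> d n"
      then have "norm (t n) * r \<le> norm (t n) * \<bar>d n\<bar>" by (intro mult_left_mono) auto
      then show "norm (t n) * r < e" using elim by (simp add: norm_mult)
    qed
  qed
qed

lemma Lambda1_eq_koethe:
  "Lambda1 \<alpha> = koethe (\<lambda>k n. exp (- (\<alpha> n / real (Suc k))))"
  "Lambda1_norm \<alpha> = koethe_norm (\<lambda>k n. exp (- (\<alpha> n / real (Suc k))))"
  by (simp_all add: Lambda1_def koethe_def Lambda1_norm_def koethe_norm_def fun_eq_iff)

lemma Lambda_inf_eq_koethe:
  "Lambda_inf \<alpha> = koethe (\<lambda>k n. exp (real (Suc k) * \<alpha> n))"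
  "Lambda_inf_norm \<alpha> = koethe_norm (\<lambda>k n. exp (real (Suc k) * \<alpha> n))"
  by (simp_all add: Lambda_inf_def koethe_def Lambda_inf_norm_def koethe_norm_def fun_eq_iff)

lemma koethe_matrix_Lambda1:
  "(\<And>n. 0 \<le> \<alpha> n) \<Longrightarrow> koethe_matrix (\<lambda>k n. exp (- (\<alpha> n / real (Suc k))))"
  by unfold_locales (auto simp: incseq_def intro!: divide_left_mono)

lemma koethe_matrix_Lambda_inf:
  "(\<And>n. 0 \<le> \<alpha> n) \<Longrightarrow> koethe_matrix (\<lambda>k n. exp (real (Suc k) * \<alpha> n))"
  by unfold_locales (auto simp: incseq_def intro!: mult_right_mono)

lemma subexponential_subset_diametral_dimension_Lambda_inf:
  assumes "exponent_sequence \<alpha>"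
  shows "subexponential \<alpha> \<subseteq> diametral_dimension seq_scale (Lambda_inf \<alpha>) (Lambda_inf_norm \<alpha>)"
  unfolding Lambda_inf_eq_koethe
proof (rule koethe_matrix.subexponential_subset_diametral_dimension)
  show "koethe_matrix (\<lambda>k n. exp (real (Suc k) * \<alpha> n))"
    using assms by (intro koethe_matrix_Lambda_inf) (simp add: exponent_sequence_def)
  show "incseq \<alpha>" using assms by (simp add: exponent_sequence_def)
  show "\<exists>c>0. \<forall>m. exp (real (Suc k) * \<alpha> m) \<le> exp (- (c * \<alpha> m)) * exp (real (Suc (Suc k)) * \<alpha> m)" for k
    unfolding exp_add[symmetric] by (intro exI[of _ 1]) (simp add: algebra_simps)
qed

lemma diametral_dimension_Lambda1:
  assumes \<alpha>: "exponent_sequence \<alpha>"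
  shows "diametral_dimension seq_scale (Lambda1 \<alpha>) (Lambda1_norm \<alpha>)
    = (subexponential \<alpha> :: (nat \<Rightarrow> 'k::real_normed_field) set)"
  unfolding Lambda1_eq_koethe
proof
  have \<alpha>0: "0 \<le> \<alpha> n" for n using \<alpha> by (simp add: exponent_sequence_def)
  have inc: "incseq \<alpha>" using \<alpha> by (simp add: exponent_sequence_def)
  let ?w = "\<lambda>k n. exp (- (\<alpha> n / real (Suc k)))"
  interpret koethe_matrix ?w by (rule koethe_matrix_Lambda1) (rule \<alpha>0)
  show "subexponential \<alpha> \<subseteq> diametral_dimension seq_scale (koethe ?w) (koethe_norm ?w)"
  proof (rule subexponential_subset_diametral_dimension[OF inc])
    fix k
    show "\<exists>c>0. \<forall>m. ?w k m \<le> exp (- (c * \<alpha> m)) * ?w (Suc k) m"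
      unfolding exp_add[symmetric]
    proof (intro exI[of _ "1 / real (Suc k) - 1 / real (Suc (Suc k))"] conjI allI)
      show "0 < 1 / real (Suc k) - 1 / real (Suc (Suc k))"
        using divide_strict_left_mono[of "real (Suc k)" "real (Suc (Suc k))" 1] by simp
    qed (simp add: left_diff_distrib)
  qed
  show "diametral_dimension seq_scale (koethe ?w) (koethe_norm ?w) \<subseteq> (subexponential \<alpha> :: (nat \<Rightarrow> 'k) set)"
  proof
    fix t :: "nat \<Rightarrow> 'k" assume t: "t \<in> diametral_dimension seq_scale (koethe ?w) (koethe_norm ?w)"
    show "t \<in> subexponential \<alpha>"
      unfolding subexponential_def
    proof (intro CollectI allI impI)
      fix \<delta> :: real assume \<delta>: "0 < \<delta>"
      then obtain k where k: "1 / real (Suc k) < \<delta>" using nat_approx_posE by blast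
      obtain q where q: "k < q" and lim: "(\<lambda>n. t n * of_real (kolmogorov_diameter (seq_scale :: 'k \<Rightarrow> _) (koethe ?w) n
          (unit_ball (koethe ?w) (koethe_norm ?w) q) (unit_ball (koethe ?w) (koethe_norm ?w) k))) \<longlonglongrightarrow> 0"
        using t unfolding diametral_dimension_def by blast
      have ge: "exp (- (\<delta> * \<alpha> n)) \<le> kolmogorov_diameter (seq_scale :: 'k \<Rightarrow> _) (koethe ?w) n
          (unit_ball (koethe ?w) (koethe_norm ?w) q) (unit_ball (koethe ?w) (koethe_norm ?w) k)" for n
      proof (rule kolmogorov_diameter_ge[of "{..n}"])
        fix m assume "m \<in> {..n}"
        then have "\<alpha> m / real (Suc k) \<le> \<delta> * \<alpha> n"
          using mult_mono[of "1 / real (Suc k)" \<delta> "\<alpha> m" "\<alpha> n"] k \<delta> inc \<alpha>0 by (auto simp: incseq_def)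
        moreover have "0 \<le> \<alpha> m / real (Suc q)" using \<alpha>0 by simp
        ultimately show "exp (- (\<delta> * \<alpha> n)) * ?w q m \<le> ?w k m"
          unfolding exp_add[symmetric] by simp
      qed (use q in auto)
      show "(\<lambda>n. norm (t n) * exp (- (\<delta> * \<alpha> n))) \<longlonglongrightarrow> 0"
      proof (rule LIMSEQ_I)
        fix e :: real assume "0 < e"
        have "\<forall>\<^sub>F n in sequentially. norm (norm (t n) * exp (- (\<delta> * \<alpha> n)) - 0) < e"
          using null_sequence_of_diameter_bound[OF lim \<open>0 < e\<close>]
        proof eventually_elim
          case (elim n)
          show ?case using elim[rule_format, of "exp (- (\<delta> * \<alpha> n))"] ge[of n] by simp
        qed
        then show "\<exists>N. \<forall>n\<ge>N. norm (norm (t n) * exp (- (\<delta> * \<alpha> n)) - 0) < e"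
          by (simp add: eventually_sequentially)
      qed
    qed
  qed
qed

section \<open>A Koethe space with jumps\<close>

text \<open>
  Any function that takes every value infinitely often would do; the first component of a pair coded
  by \<open>n\<close> is one.
\<close>

definition jump :: "nat \<Rightarrow> nat" where
  "jump n = fst (prod_decode n)"

definition profile :: "nat \<Rightarrow> nat \<Rightarrow> real" where
  "profile k n = (if jump n < k then 1 else 0) - 1 / real (Suc k)"

definition jump_weight :: "nat \<Rightarrow> nat \<Rightarrow> real" where
  "jump_weight k n = exp (fact n * profile k n)"

text \<open>
  The growth of a profile from level \<open>k\<close> to level \<open>k + 1\<close>, apart from the jump.
\<close>

definition increment :: "nat \<Rightarrow> real" where
  "increment k = 1 / real (Suc k) - 1 / real (Suc (Suc k))"

lemma increment_pos: "0 < increment k"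
  unfolding increment_def
  using divide_strict_left_mono[of "real (Suc k)" "real (Suc (Suc k))" 1] by simp

lemma increment_le_1: "increment k \<le> 1"
proof -
  have "1 / real (Suc k) \<le> 1" "0 \<le> 1 / real (Suc (Suc k))" by simp_all
  then show ?thesis unfolding increment_def by linarith
qed

lemma jump_cofinal: "\<exists>n\<ge>N. jump n = J"
  by (rule exI[of _ "prod_encode (J, N)"]) (simp add: jump_def le_prod_encode_2)

lemma profile_Suc: "profile (Suc k) n = profile k n + increment k + (if jump n = k then 1 else 0)"
  by (auto simp: profile_def increment_def)

lemma profile_ge: "k \<le> l \<Longrightarrow> profile k n \<le> profile l n"
proof (induction l rule: dec_induct)
  case (step l)
  then show ?case using increment_pos[of l] by (simp add: profile_Suc)
qed simp

lemma profile_diff_le_2: "profile k n - profile l n \<le> 2"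
proof -
  have "0 \<le> 1 / real (Suc k)" "1 / real (Suc l) \<le> 1" by simp_all
  then show ?thesis unfolding profile_def by (smt (verit))
qed

text \<open>
  Away from its jump a profile has little room left after level \<open>p\<close>, however large \<open>q\<close> is.
\<close>

lemma profile_diff_le:
  assumes "jump n < p \<or> q \<le> jump n"
  shows "profile q n - profile p n \<le> 1 / real (Suc p)"
proof -
  have "0 \<le> 1 / real (Suc q)" by simp
  moreover have "(if jump n < q then 1 else (0 :: real)) \<le> (if jump n < p then 1 else 0)"
    using assms by auto
  ultimately show ?thesis unfolding profile_def by linarith
qed

interpretation jump_space: koethe_matrix jump_weight
proof
  show "incseq (\<lambda>k. jump_weight k n)" for n
    unfolding jump_weight_def incseq_def by (simp add: profile_ge mult_left_mono)
qed (simp add: jump_weight_def)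

lemma jump_weight_step: "jump_weight k n \<le> exp (- (increment k * fact n)) * jump_weight (Suc k) n"
proof -
  have "fact n * (profile k n + increment k) \<le> fact n * profile (Suc k) n"
    by (intro mult_left_mono) (auto simp: profile_Suc)
  then show ?thesis
    unfolding jump_weight_def exp_add[symmetric] by (simp add: algebra_simps)
qed

lemma jump_weight_powr:
  "jump_weight a n powr u * jump_weight b n powr v = exp (fact n * (u * profile a n + v * profile b n))"
  unfolding jump_weight_def powr_def by (simp add: exp_add[symmetric] algebra_simps)

lemma fact_ge_real: "real n \<le> fact n"
  by (metis fact_ge_self of_nat_fact of_nat_le_iff)

lemma summable_exp_neg_fact:
  assumes "0 < c" shows "summable (\<lambda>n. exp (- (c * fact n)) :: real)"
proof (rule summable_comparison_test'[of "\<lambda>n. exp (- c) ^ n" 0])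
  show "summable (\<lambda>n. exp (- c) ^ n)" using assms by (intro summable_geometric) simp
  show "norm (exp (- (c * fact n))) \<le> exp (- c) ^ n" for n
    using mult_left_mono[OF fact_ge_real[of n], of c] assms
    by (simp add: exp_of_nat_mult[symmetric] mult.commute)
qed

lemma exponent_sequence_fact: "exponent_sequence fact"
  unfolding exponent_sequence_def
proof (intro conjI allI)
  show "incseq (fact :: nat \<Rightarrow> real)" by (auto simp: incseq_def intro: fact_mono)
  show "filterlim (fact :: nat \<Rightarrow> real) at_top sequentially"
    by (rule filterlim_at_top_mono[OF filterlim_real_sequentially]) (simp add: fact_ge_real)
qed simp

section \<open>Nuclearity and interpolation of the norms\<close>

lemma nuclear_jump_space:
  "nuclear (seq_scale :: 'k::real_normed_field \<Rightarrow> _) (koethe jump_weight) (koethe_norm jump_weight)"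
proof (rule jump_space.nuclear_koethe)
  fix k
  show "summable (\<lambda>n. jump_weight k n / jump_weight (Suc k) n)"
  proof (rule summable_comparison_test'[OF summable_exp_neg_fact[OF increment_pos[of k]], of 0])
    fix n
    show "norm (jump_weight k n / jump_weight (Suc k) n) \<le> exp (- (increment k * fact n))"
      using jump_weight_step[of k n] jump_space.pos[of k n] jump_space.pos[of "Suc k" n]
      by (simp add: pos_divide_le_eq)
  qed
qed

lemma property_DN_jump_space:
  "property_DN (koethe jump_weight :: (nat \<Rightarrow> 'k::real_normed_field) set) (koethe_norm jump_weight)"
proof (rule jump_space.property_DN_koethe[where k=0])
  fix j
  let ?\<kappa> = "increment j / 2"
  \<comment> \<open>Half the increment, because profiles lie in an interval of length 2.\<close>
  have "jump_weight j n \<le> jump_weight 0 n powr ?\<kappa> * jump_weight (Suc j) n powr (1 - ?\<kappa>)" for n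
  proof -
    have "?\<kappa> * (profile (Suc j) n - profile 0 n) \<le> increment j"
      using mult_left_mono[OF profile_diff_le_2[of "Suc j" n 0], of ?\<kappa>] increment_pos[of j] by simp
    also have "\<dots> \<le> profile (Suc j) n - profile j n" by (simp add: profile_Suc)
    finally have "profile j n \<le> ?\<kappa> * profile 0 n + (1 - ?\<kappa>) * profile (Suc j) n"
      by (simp add: algebra_simps)
    then show ?thesis
      unfolding jump_weight_powr jump_weight_def[of j] by (simp add: mult_left_mono)
  qed
  moreover have "0 < ?\<kappa>" "?\<kappa> < 1" using increment_pos[of j] increment_le_1[of j] by linarith+
  ultimately show "\<exists>l \<kappa>. 0 < \<kappa> \<and> \<kappa> < 1 \<and>
      (\<forall>n. jump_weight j n \<le> jump_weight 0 n powr \<kappa> * jump_weight l n powr (1 - \<kappa>))" by blast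
qed

lemma property_Omega_jump_space:
  "property_Omega (seq_scale :: 'k::real_normed_field \<Rightarrow> _) (koethe jump_weight) (koethe_norm jump_weight)"
proof (rule jump_space.property_Omega_koethe)
  fix m
  let ?\<theta> = "increment m / 2"
  have "jump_weight m n powr (1 - ?\<theta>) * jump_weight k n powr ?\<theta> \<le> jump_weight (Suc m) n" for k n
  proof -
    have "?\<theta> * (profile k n - profile m n) \<le> increment m"
      using mult_left_mono[OF profile_diff_le_2[of k n m], of ?\<theta>] increment_pos[of m] by simp
    also have "\<dots> \<le> profile (Suc m) n - profile m n" by (simp add: profile_Suc)
    finally have "(1 - ?\<theta>) * profile m n + ?\<theta> * profile k n \<le> profile (Suc m) n"
      by (simp add: algebra_simps)
    then show ?thesis
      unfolding jump_weight_powr jump_weight_def[of "Suc m"] by (simp add: mult_left_mono)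
  qed
  moreover have "0 < ?\<theta>" "?\<theta> < 1" using increment_pos[of m] increment_le_1[of m] by linarith+
  ultimately show "\<exists>q. \<forall>k. \<exists>\<theta>. 0 < \<theta> \<and> \<theta> < 1 \<and>
      (\<forall>n. jump_weight m n powr (1 - \<theta>) * jump_weight k n powr \<theta> \<le> jump_weight q n)" by blast
qed

section \<open>The diametral dimension does not see the jumps\<close>

text \<open>
  This separates the scales of different coordinates: \<open>m!\<close> is negligible against \<open>n!\<close> for \<open>m < n\<close>.
\<close>

lemma fact_growth: "m < n \<Longrightarrow> real n * fact m \<le> fact n"
proof -
  assume "m < n"
  then obtain l where l: "n = Suc l" "m \<le> l" by (cases n) auto
  then have "fact m \<le> (fact l :: real)" by (intro fact_mono)
  then show ?thesis using l by (simp add: mult_left_mono)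
qed

text \<open>
  A single pair \<open>p < q\<close> does not bound the diameters from below, because they are as small as
  \<open>exp (-n!)\<close> at the \<open>n\<close> with \<open>p \<le> jump n < q\<close>. The bound comes from two adjacent pairs.
\<close>

lemma diametral_dimension_jump_space:
  "diametral_dimension (seq_scale :: 'k::real_normed_field \<Rightarrow> _) (koethe jump_weight) (koethe_norm jump_weight)
    = subexponential fact"
proof
  let ?d = "\<lambda>n q p. kolmogorov_diameter (seq_scale :: 'k \<Rightarrow> _) (koethe jump_weight) n
    (unit_ball (koethe jump_weight) (koethe_norm jump_weight) q)
    (unit_ball (koethe jump_weight) (koethe_norm jump_weight) p)"
  show "subexponential fact
      \<subseteq> diametral_dimension (seq_scale :: 'k \<Rightarrow> _) (koethe jump_weight) (koethe_norm jump_weight)"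
    using jump_weight_step increment_pos exponent_sequence_fact
    by (intro jump_space.subexponential_subset_diametral_dimension) (auto simp: exponent_sequence_def)
  have diameter_ge: "exp (- (\<delta> * fact n)) \<le> ?d n q p"
    if "p < q" "1 / real (Suc p) \<le> \<delta>" "2 / \<delta> \<le> real n" "jump n < p \<or> q \<le> jump n" for \<delta> p q n
  proof (rule jump_space.kolmogorov_diameter_ge[of "{..n}"])
    fix m assume m: "m \<in> {..n}"
    have "0 < 1 / real (Suc p)" by simp
    then have \<delta>: "0 < \<delta>" using that(2) by linarith
    have "fact m * (profile q m - profile p m) \<le> \<delta> * fact n"
    proof (cases "m = n")
      case True
      then show ?thesis
        using mult_left_mono[of "profile q n - profile p n" \<delta> "fact n"]
          profile_diff_le[OF that(4)] that(2) by (simp add: mult.commute)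
    next
      case False
      then have "real n * fact m \<le> fact n" using m by (intro fact_growth) simp
      moreover have "2 \<le> \<delta> * real n" using that(3) \<delta> by (simp add: pos_divide_le_eq mult.commute)
      ultimately have "2 * fact m \<le> \<delta> * real n * fact m" "\<delta> * (real n * fact m) \<le> \<delta> * fact n"
        using \<delta> by (auto intro: mult_right_mono mult_left_mono)
      then have "2 * fact m \<le> \<delta> * fact n" by (simp only: mult.assoc)
      moreover have "fact m * (profile q m - profile p m) \<le> fact m * 2"
        by (intro mult_left_mono profile_diff_le_2) simp
      ultimately show ?thesis by linarith
    qed
    then show "exp (- (\<delta> * fact n)) * jump_weight q m \<le> jump_weight p m"
      unfolding jump_weight_def exp_add[symmetric] by (simp add: algebra_simps)
  qed (use that in auto)
  show "diametral_dimension (seq_scale :: 'k \<Rightarrow> _) (koethe jump_weight) (koethe_norm jump_weight)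
      \<subseteq> subexponential fact"
  proof
    fix t :: "nat \<Rightarrow> 'k"
    assume t: "t \<in> diametral_dimension seq_scale (koethe jump_weight) (koethe_norm jump_weight)"
    have ex: "\<exists>q>p. (\<lambda>n. t n * of_real (?d n q p)) \<longlonglongrightarrow> 0" for p
      using t unfolding diametral_dimension_def by blast
    show "t \<in> subexponential fact"
      unfolding subexponential_def
    proof (intro CollectI allI impI)
      fix \<delta> :: real assume \<delta>: "0 < \<delta>"
      then obtain p where p: "1 / real (Suc p) < \<delta>" by (rule nat_approx_posE)
      obtain q where q: "p < q" "(\<lambda>n. t n * of_real (?d n q p)) \<longlonglongrightarrow> 0" using ex by blast
      obtain r where r: "q < r" "(\<lambda>n. t n * of_real (?d n r q)) \<longlonglongrightarrow> 0" using ex by blast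
      have q': "1 / real (Suc q) \<le> \<delta>"
        using divide_left_mono[of "real (Suc p)" "real (Suc q)" 1] q(1) p by simp
      show "(\<lambda>n. norm (t n) * exp (- (\<delta> * fact n))) \<longlonglongrightarrow> 0"
      proof (rule LIMSEQ_I)
        fix e :: real assume e: "0 < e"
        have "\<forall>\<^sub>F n in sequentially. 2 / \<delta> \<le> real n"
          using filterlim_real_sequentially by (simp add: filterlim_at_top)
        with null_sequence_of_diameter_bound[OF q(2) e] null_sequence_of_diameter_bound[OF r(2) e]
        have "\<forall>\<^sub>F n in sequentially. norm (norm (t n) * exp (- (\<delta> * fact n)) - 0) < e"
        proof eventually_elim
          case (elim n)
          consider "jump n < p \<or> q \<le> jump n" | "jump n < q \<or> r \<le> jump n" by linarith
          then have "exp (- (\<delta> * fact n)) \<le> ?d n q p \<or> exp (- (\<delta> * fact n)) \<le> ?d n r q"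
            by cases (use diameter_ge[OF q(1)] diameter_ge[OF r(1)] p q' elim(3) in auto)
          then have "norm (t n) * exp (- (\<delta> * fact n)) < e"
            using elim(1,2) by (metis exp_ge_zero)
          then show ?case by simp
        qed
        then show "\<exists>N. \<forall>n\<ge>N. norm (norm (t n) * exp (- (\<delta> * fact n)) - 0) < e"
          by (simp add: eventually_sequentially)
      qed
    qed
  qed
qed

section \<open>Embeddings of power series spaces see the jumps\<close>

text \<open>
  On the scale of \<open>n!\<close> the logarithms of the norms of the image of a unit sequence have to rise to 0
  by infinitely many small steps, at the same pace for all \<open>n\<close>. A space in which the only coordinate of the right scale climbs by one big
  step, arbitrarily late, does not allow this.
\<close>

lemma no_power_series_subspace_of_jump_space:
  fixes \<epsilon> :: "nat \<Rightarrow> real"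
  assumes \<epsilon>: "exponent_sequence \<epsilon>" and C: "0 < C"
    and upper: "\<And>n. \<epsilon> n \<le> C * (fact n + 1)" and lower: "\<And>n. fact n \<le> C * (\<epsilon> n + 1)"
  shows "\<not> has_subspace_isomorphic_to (seq_scale :: 'k::real_normed_field \<Rightarrow> _)
    (koethe jump_weight) (koethe_norm jump_weight) seq_scale (Lambda1 \<epsilon>) (Lambda1_norm \<epsilon>)"
proof
  assume emb: "has_subspace_isomorphic_to (seq_scale :: 'k \<Rightarrow> _)
    (koethe jump_weight) (koethe_norm jump_weight) seq_scale (Lambda1 \<epsilon>) (Lambda1_norm \<epsilon>)"
  let ?w = "\<lambda>k n. exp (- (\<epsilon> n / real (Suc k)))"
  have \<epsilon>0: "0 \<le> \<epsilon> n" for n using \<epsilon> by (simp add: exponent_sequence_def)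
  interpret source: koethe_matrix ?w by (rule koethe_matrix_Lambda1) (rule \<epsilon>0)
  obtain f :: "(nat \<Rightarrow> 'k) \<Rightarrow> nat \<Rightarrow> 'k" where f_in: "\<And>x. x \<in> koethe ?w \<Longrightarrow> f x \<in> koethe jump_weight"
    and f_cont: "\<And>k. \<exists>l C. 0 < C \<and> (\<forall>x\<in>koethe ?w. koethe_norm jump_weight k (f x) \<le> C * koethe_norm ?w l x)"
    and f_open: "\<And>k. \<exists>l C. 0 < C \<and> (\<forall>x\<in>koethe ?w. koethe_norm ?w k x \<le> C * koethe_norm jump_weight l (f x))"
    using subspace_isomorphism_bounds[OF jump_space.seminormed_space_koethe source.seminormed_space_koethe,
        OF emb[unfolded Lambda1_eq_koethe]] by blast
  define X where "X n = f (unit_seq n)" for n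
  define P where "P k n = koethe_norm jump_weight k (X n)" for k n
  have X: "X n \<in> koethe jump_weight" for n
    unfolding X_def by (intro f_in source.unit_seq_in_koethe)
  have coordinate: "norm (X n m) * jump_weight k m \<le> P l n * exp (fact m * (profile k m - profile l m))" for n m k l
  proof -
    have "jump_weight k m = jump_weight l m * exp (fact m * (profile k m - profile l m))"
      unfolding jump_weight_def exp_add[symmetric] by (simp add: algebra_simps)
    then show ?thesis
      using mult_right_mono[OF jump_space.term_le_norm[OF X[of n], of m l], of "exp (fact m * (profile k m - profile l m))"]
      by (simp add: P_def mult.assoc)
  qed
  \<comment> \<open>The two halves of the embedding estimate, rewritten from \<open>\<epsilon>\<close> to the factorials.\<close>
  have P_le: "\<exists>h>0. \<exists>D>0. \<forall>n. P k n \<le> D * exp (- (h * fact n))" for k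
  proof -
    obtain l D where D: "0 < D" "\<And>x. x \<in> koethe ?w \<Longrightarrow> koethe_norm jump_weight k (f x) \<le> D * koethe_norm ?w l x"
      using f_cont by blast
    let ?h = "1 / (C * real (Suc l))"
    have "P k n \<le> D * exp (1 / real (Suc l)) * exp (- (?h * fact n))" for n
    proof -
      have "P k n \<le> D * ?w l n"
        using D(2)[OF source.unit_seq_in_koethe, of n] by (simp only: P_def X_def source.koethe_norm_unit_seq)
      also have "?w l n \<le> exp (1 / real (Suc l) - ?h * fact n)"
      proof -
        have "fact n / C \<le> \<epsilon> n + 1" using lower[of n] C by (simp add: pos_divide_le_eq mult.commute)
        then have "fact n / C / real (Suc l) \<le> (\<epsilon> n + 1) / real (Suc l)" by (rule divide_right_mono) simp
        then have "?h * fact n \<le> \<epsilon> n / real (Suc l) + 1 / real (Suc l)" by (simp add: add_divide_distrib)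
        then show ?thesis by simp
      qed
      also have "\<dots> = exp (1 / real (Suc l)) * exp (- (?h * fact n))"
        unfolding exp_add[symmetric] by simp
      finally show ?thesis using D(1) by (simp add: mult.assoc)
    qed
    then show ?thesis using D(1) C
      by (intro exI[of _ ?h] conjI exI[of _ "D * exp (1 / real (Suc l))"]) auto
  qed
  have P_ge: "\<exists>k. \<exists>D>0. \<forall>n. exp (- (\<tau> * fact n)) \<le> D * P k n" if \<tau>: "0 < \<tau>" for \<tau>
  proof -
    have "0 < \<tau> / C" using \<tau> C by simp
    then obtain i where i: "1 / real (Suc i) < \<tau> / C" by (rule nat_approx_posE)
    obtain k D where D: "0 < D" "\<And>x. x \<in> koethe ?w \<Longrightarrow> koethe_norm ?w i x \<le> D * koethe_norm jump_weight k (f x)"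
      using f_open by blast
    have "exp (- (\<tau> * fact n)) \<le> exp \<tau> * D * P k n" for n
    proof -
      have "\<epsilon> n * (1 / real (Suc i)) \<le> C * (fact n + 1) * (\<tau> / C)"
        using upper[of n] \<epsilon>0[of n] i C by (intro mult_mono) auto
      then have "\<epsilon> n / real (Suc i) \<le> \<tau> + \<tau> * fact n" using C by (simp add: algebra_simps)
      then have "exp (- (\<tau> * fact n)) \<le> exp \<tau> * ?w i n" unfolding exp_add[symmetric] by simp
      also have "?w i n \<le> D * P k n"
        using D(2)[OF source.unit_seq_in_koethe, of n] by (simp only: P_def X_def source.koethe_norm_unit_seq)
      finally show ?thesis by (simp add: mult.assoc)
    qed
    then show ?thesis using D(1) by (intro exI[of _ k] exI[of _ "exp \<tau> * D"]) auto
  qed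
  obtain h D0 where h: "0 < h" and D0: "0 < D0" "\<And>n. P 0 n \<le> D0 * exp (- (h * fact n))"
    using P_le by blast
  \<comment> \<open>The \<open>J\<close>-th norm will be shown to be of the order \<open>exp (-\<sigma> n!)\<close>, while \<open>J\<close> is chosen so that it
     is at least of the order \<open>exp (-\<sigma> n! / 2)\<close>.\<close>
  define \<sigma> where "\<sigma> = min (h / 2) (1 / 2)"
  have \<sigma>: "0 < \<sigma>" "\<sigma> \<le> h / 2" "\<sigma> \<le> 1 / 2" using h by (auto simp: \<sigma>_def)
  have "0 < \<sigma> / 2" using \<sigma> by simp
  then obtain J D1 where D1: "0 < D1" "\<And>n. exp (- (\<sigma> / 2 * fact n)) \<le> D1 * P J n"
    using P_ge by blast
  obtain D2 where D2: "0 < D2" "\<And>n. P (Suc J) n \<le> D2"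
  proof -
    obtain h' D where hD: "0 < h'" "0 < D" "\<And>n. P (Suc J) n \<le> D * exp (- (h' * fact n))"
      using P_le by blast
    have "D * exp (- (h' * fact n)) \<le> D * 1" for n using hD by (intro mult_left_mono) auto
    then have "P (Suc J) n \<le> D" for n using hD(3)[of n] order_trans by fastforce
    then show thesis using hD(2) that by blast
  qed
  define S where "S = (\<Sum>m. exp (- real m))"
  have S: "summable (\<lambda>m. exp (- real m))"
    using summable_geometric[of "exp (- 1 :: real)"] by (simp add: exp_of_nat_mult[symmetric])
  define K where "K = D1 * ((D0 + D2) * S)"
  obtain N where N: "max (max (6 / h) (2 / increment J)) (max 3 (2 / \<sigma> * K + 1)) \<le> real N"
    using real_arch_simple by blast
  obtain n where n: "N \<le> n" "jump n = J" using jump_cofinal by blast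
  have nN: "6 / h \<le> real n" "2 / increment J \<le> real n" "3 \<le> real n" "2 / \<sigma> * K + 1 \<le> real n"
    using N n(1) by auto
  \<comment> \<open>The factor \<open>exp (-m)\<close> makes the bounds summable. Coordinates before \<open>n\<close> are estimated by the norm
     with index 0, the others by the norm with index \<open>J + 1\<close>.\<close>
  have coordinate_bound: "norm (X n m) * jump_weight J m \<le> (D0 + D2) * exp (- (\<sigma> * fact n)) * exp (- real m)" for m
  proof (cases "m < n")
    case True
    have "fact m * (profile J m - profile 0 m) \<le> fact m * 2"
      by (intro mult_left_mono profile_diff_le_2) simp
    moreover have "2 * fact m + real m \<le> h / 2 * fact n"
    proof -
      have "2 * fact m + real m \<le> 3 * fact m" using fact_ge_real[of m] by simp
      also have "\<dots> \<le> h / 2 * real n * fact m"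
        using nN(1) h by (intro mult_right_mono) (auto simp: pos_divide_le_eq mult.commute)
      also have "\<dots> \<le> h / 2 * fact n"
        using mult_left_mono[OF fact_growth[OF True], of "h / 2"] h by (simp add: mult.assoc)
      finally show ?thesis .
    qed
    moreover have "\<sigma> * fact n \<le> h / 2 * fact n" using \<sigma>(2) by (rule mult_right_mono) simp
    ultimately have e: "- (h * fact n) + fact m * (profile J m - profile 0 m) \<le> - (\<sigma> * fact n) + - real m"
      by linarith
    have "norm (X n m) * jump_weight J m \<le> D0 * exp (- (h * fact n)) * exp (fact m * (profile J m - profile 0 m))"
      using coordinate[of n m J 0] mult_right_mono[OF D0(2)[of n]] by (rule order_trans) simp
    also have "\<dots> = D0 * exp (- (h * fact n) + fact m * (profile J m - profile 0 m))"
      by (simp only: exp_add mult.assoc)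
    also have "\<dots> \<le> (D0 + D2) * exp (- (\<sigma> * fact n) + - real m)"
      using e D0(1) D2(1) by (intro mult_mono) auto
    finally show ?thesis by (simp only: exp_add mult.assoc)
  next
    case False
    have e: "fact m * (profile J m - profile (Suc J) m) \<le> - (\<sigma> * fact n) + - real m"
    proof (cases "m = n")
      case True
      have "profile J m - profile (Suc J) m \<le> - 1"
        using True n(2) increment_pos[of J] by (simp add: profile_Suc)
      then have "fact m * (profile J m - profile (Suc J) m) \<le> fact m * (- 1)" by (rule mult_left_mono) simp
      moreover have "2 * real n \<le> fact n"
      proof -
        have "2 \<le> (fact (n - 1) :: real)" using fact_ge_real[of "n - 1"] nN(3) by linarith
        then have "real n * 2 \<le> real n * fact (n - 1)" by (rule mult_left_mono) simp
        also have "\<dots> \<le> fact n" using nN(3) by (intro fact_growth) simp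
        finally show ?thesis by simp
      qed
      moreover have "\<sigma> * fact n \<le> 1 / 2 * fact n" using \<sigma>(3) by (rule mult_right_mono) simp
      ultimately show ?thesis unfolding True by linarith
    next
      case mn: False
      then have m: "n \<le> m - 1" "m - 1 < m" "3 \<le> real m" using False nN(3) by auto
      have "profile J m - profile (Suc J) m \<le> - increment J" by (simp add: profile_Suc)
      then have "fact m * (profile J m - profile (Suc J) m) \<le> fact m * (- increment J)"
        by (rule mult_left_mono) simp
      moreover have "2 * fact (m - 1) \<le> increment J * fact m"
      proof -
        have "2 \<le> increment J * real n"
          using nN(2) increment_pos[of J] by (simp add: pos_divide_le_eq mult.commute)
        also have "\<dots> \<le> increment J * real m"
          using False less_imp_le[OF increment_pos] by (intro mult_left_mono) simp_all
        finally have "2 * fact (m - 1) \<le> increment J * real m * fact (m - 1)"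
          by (rule mult_right_mono) simp
        also have "\<dots> \<le> increment J * fact m"
          using mult_left_mono[OF fact_growth[OF m(2)], of "increment J"] increment_pos[of J]
          by (simp add: mult.assoc)
        finally show ?thesis .
      qed
      moreover have "fact n \<le> (fact (m - 1) :: real)" by (rule fact_mono[OF m(1)])
      moreover have "\<sigma> * fact n \<le> 1 / 2 * fact n" using \<sigma>(3) by (rule mult_right_mono) simp
      moreover have "real m - 1 \<le> fact (m - 1)" using fact_ge_real[of "m - 1"] m(3) by linarith
      ultimately show ?thesis using m(3) unfolding mult_minus_right mult.commute[of "fact m"] by linarith
    qed
    have "norm (X n m) * jump_weight J m \<le> D2 * exp (fact m * (profile J m - profile (Suc J) m))"
      using coordinate[of n m J "Suc J"] mult_right_mono[OF D2(2)[of n]] by (rule order_trans) simp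
    also have "\<dots> \<le> (D0 + D2) * exp (- (\<sigma> * fact n) + - real m)"
      using e D0(1) D2(1) by (intro mult_mono) auto
    finally show ?thesis by (simp only: exp_add mult.assoc)
  qed
  have "P J n \<le> (\<Sum>m. (D0 + D2) * exp (- (\<sigma> * fact n)) * exp (- real m))"
    unfolding P_def koethe_norm_def
    by (intro suminf_le coordinate_bound jump_space.koethe_summable X summable_mult S)
  also have "\<dots> = (D0 + D2) * S * exp (- (\<sigma> * fact n))"
    unfolding S_def using suminf_mult[OF S, of "(D0 + D2) * exp (- (\<sigma> * fact n))"] by simp
  finally have "D1 * P J n \<le> K * exp (- (\<sigma> * fact n))"
    using mult_left_mono[of "P J n" "(D0 + D2) * S * exp (- (\<sigma> * fact n))" D1] D1(1)
    by (simp add: K_def mult.assoc)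
  with D1(2)[of n] have "exp (- (\<sigma> / 2 * fact n)) \<le> K * exp (- (\<sigma> * fact n))" by (rule order_trans)
  then have "exp (- (\<sigma> / 2 * fact n)) * exp (\<sigma> * fact n) \<le> K * exp (- (\<sigma> * fact n)) * exp (\<sigma> * fact n)"
    by (rule mult_right_mono) simp
  then have "exp (\<sigma> / 2 * fact n) \<le> K"
    by (simp only: mult.assoc exp_add[symmetric]) simp
  moreover have "\<sigma> / 2 * fact n \<le> exp (\<sigma> / 2 * fact n)"
    using exp_ge_add_one_self[of "\<sigma> / 2 * fact n"] by linarith
  moreover have "\<sigma> / 2 * real n \<le> \<sigma> / 2 * fact n"
    using fact_ge_real[of n] \<sigma>(1) by (intro mult_left_mono) auto
  moreover have "K < \<sigma> / 2 * real n"
  proof -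
    have "\<sigma> / 2 * (2 / \<sigma> * K + 1) \<le> \<sigma> / 2 * real n" using nN(4) \<sigma>(1) by (intro mult_left_mono) auto
    moreover have "\<sigma> / 2 * (2 / \<sigma> * K + 1) = K + \<sigma> / 2" using \<sigma>(1) by (simp add: distrib_left)
    ultimately show ?thesis using \<sigma>(1) by linarith
  qed
  ultimately show False by linarith
qed

text \<open>
  For an arbitrary associated exponent sequence \<open>\<epsilon>\<close> the defining inclusions force equality of the
  sequences of subexponential growth in \<open>\<epsilon>\<close> and in \<open>n!\<close>, hence equivalence of the exponents, so that
  one nonembedding lemma for exponents comparable to \<open>n!\<close> covers all of them.
\<close>

theorem theorem4p1:
  shows "\<exists>(E :: (nat \<Rightarrow> 'k::{real_normed_field, euclidean_space}) set) (p :: nat \<Rightarrow> (nat \<Rightarrow> 'k) \<Rightarrow> real).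
    frechet_space seq_scale E p \<and> nuclear seq_scale E p \<and>
    property_DN E p \<and> property_Omega seq_scale E p \<and>
    (\<exists>\<epsilon>. associated_exponent_sequence seq_scale E p \<epsilon>) \<and>
    (\<forall>\<epsilon>. associated_exponent_sequence seq_scale E p \<epsilon> \<longrightarrow>
       diametral_dimension seq_scale E p
         = diametral_dimension seq_scale (Lambda1 \<epsilon>) (Lambda1_norm \<epsilon>) \<and>
       \<not> has_subspace_isomorphic_to seq_scale E p seq_scale (Lambda1 \<epsilon>) (Lambda1_norm \<epsilon>))"
proof (intro exI conjI allI impI)
  let ?E = "koethe jump_weight :: (nat \<Rightarrow> 'k) set"
  let ?p = "koethe_norm jump_weight :: nat \<Rightarrow> (nat \<Rightarrow> 'k) \<Rightarrow> real"
  let ?D = "subexponential fact :: (nat \<Rightarrow> 'k) set"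
  show "frechet_space seq_scale ?E ?p" by (rule jump_space.frechet_space_koethe)
  show "nuclear seq_scale ?E ?p" by (rule nuclear_jump_space)
  show "property_DN ?E ?p" by (rule property_DN_jump_space)
  show "property_Omega seq_scale ?E ?p" by (rule property_Omega_jump_space)
  have \<Delta>: "diametral_dimension seq_scale ?E ?p = ?D" by (rule diametral_dimension_jump_space)
  \<comment> \<open>Nuclearity of \<open>\<Lambda>\<^sub>1(n!)\<close>; this identity makes the maximality conditions applicable.\<close>
  have D_eq: "?D = Lambda1 fact"
    using subexponential_subset_Lambda1[of fact] summable_exp_neg_fact Lambda1_subset_subexponential[of fact]
    by (intro subset_antisym) auto
  show "associated_exponent_sequence seq_scale ?E ?p fact"
    unfolding associated_exponent_sequence_def \<Delta>
  proof (intro conjI allI impI)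
    show "exponent_sequence fact" by (rule exponent_sequence_fact)
    show "diametral_dimension seq_scale (Lambda1 fact) (Lambda1_norm fact) \<subseteq> ?D"
      by (simp add: diametral_dimension_Lambda1[OF exponent_sequence_fact])
    show "?D \<subseteq> diametral_dimension seq_scale (Lambda_inf fact) (Lambda_inf_norm fact)"
      by (rule subexponential_subset_diametral_dimension_Lambda_inf[OF exponent_sequence_fact])
    fix \<alpha> assume \<alpha>: "exponent_sequence \<alpha>"
    show "Lambda1 \<alpha> \<subseteq> (Lambda1 fact :: (nat \<Rightarrow> 'k) set)" if "Lambda1 \<alpha> \<subseteq> ?D"
      using that by (simp add: D_eq)
    show "Lambda_inf_dual fact \<subseteq> (Lambda_inf_dual \<alpha> :: (nat \<Rightarrow> 'k) set)" if sub: "?D \<subseteq> Lambda_inf_dual \<alpha>"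
      by (rule Lambda_inf_dual_mono[OF exponent_comparison[OF exponent_sequence_fact \<alpha> sub]])
        (use \<alpha> in \<open>simp add: exponent_sequence_def\<close>)
  qed
  fix \<epsilon> assume assoc: "associated_exponent_sequence seq_scale ?E ?p \<epsilon>"
  then have \<epsilon>: "exponent_sequence \<epsilon>" by (simp add: associated_exponent_sequence_def)
  have "(Lambda1 fact :: (nat \<Rightarrow> 'k) set) \<subseteq> Lambda1 \<epsilon>"
    using assoc exponent_sequence_fact unfolding associated_exponent_sequence_def \<Delta> D_eq by blast
  also have "\<dots> \<subseteq> subexponential \<epsilon>"
    using \<epsilon> by (intro Lambda1_subset_subexponential) (simp add: exponent_sequence_def)
  finally have "?D \<subseteq> subexponential \<epsilon>" unfolding D_eq .
  moreover have "subexponential \<epsilon> \<subseteq> ?D"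
    using assoc unfolding associated_exponent_sequence_def \<Delta> diametral_dimension_Lambda1[OF \<epsilon>] by blast
  ultimately have eq: "subexponential \<epsilon> = ?D" by blast
  then show "diametral_dimension seq_scale ?E ?p = diametral_dimension seq_scale (Lambda1 \<epsilon>) (Lambda1_norm \<epsilon>)"
    unfolding \<Delta> diametral_dimension_Lambda1[OF \<epsilon>] by simp
  have "?D \<subseteq> Lambda_inf_dual \<epsilon>" "(subexponential \<epsilon> :: (nat \<Rightarrow> 'k) set) \<subseteq> Lambda_inf_dual fact"
    using subexponential_subset_Lambda_inf_dual eq by metis+
  then obtain C C' where C: "0 < C" "\<And>n. fact n \<le> C * (\<epsilon> n + 1)" "0 < C'" "\<And>n. \<epsilon> n \<le> C' * (fact n + 1)"
    using exponent_comparison[OF exponent_sequence_fact \<epsilon>] exponent_comparison[OF \<epsilon> exponent_sequence_fact] by blast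
  show "\<not> has_subspace_isomorphic_to seq_scale ?E ?p seq_scale (Lambda1 \<epsilon>) (Lambda1_norm \<epsilon>)"
  proof (rule no_power_series_subspace_of_jump_space[OF \<epsilon>, of "max C C'"])
    fix n
    have "0 \<le> \<epsilon> n" using \<epsilon> by (simp add: exponent_sequence_def)
    then have "C * (\<epsilon> n + 1) \<le> max C C' * (\<epsilon> n + 1)" by (intro mult_right_mono) auto
    then show "fact n \<le> max C C' * (\<epsilon> n + 1)" by (rule order_trans[OF C(2)])
    have "C' * (fact n + 1) \<le> max C C' * (fact n + 1)" by (intro mult_right_mono) auto
    then show "\<epsilon> n \<le> max C C' * (fact n + 1)" by (rule order_trans[OF C(4)])
  qed (use C in simp)
qed

end
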